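(* Let $f(\mathbf z,\bar{\mathbf z})$ be a strongly non-degenerate mixed polynomial in $n$ complex variables which is locally tame along its vanishing coordinate subspaces. Put $\rho_0=\min\{r_{nc},r_0\}$, where $r_{nc}$ and $r_0$ are the numbers defined in the context. For any fixed positive number $r_1\le\rho_0$ there exists a positive number $\delta(r_1)$ (depending on $r_1$) such that: (1) for every $\eta\in\mathbb C$ with $0<|\eta|\le\delta(r_1)$, the nearby fiber $V_\eta=f^{-1}(\eta)$ has no mixed singularity in the ball $B_{\rho_0}$; (2) for every $\eta\in\mathbb C$ with $0<|\eta|\le\delta(r_1)$ and every $r$ with $r_1\le r\le\rho_0$, the sphere $S_r$ and the nearby fiber $V_\eta=f^{-1}(\eta)$ intersect transversely.
   Context: A mixed polynomial is a finite sum $f(\mathbf z,\bar{\mathbf z})=\sum_{\nu,\mu}c_{\nu\mu}\mathbf z^\nu\bar{\mathbf z}^\mu$ with $\mathbf z\in\mathbb C^n$, $\nu,\mu\in\mathbb Z_{\ge0}^n$, viewed as a real analytic map $f:\mathbb C^n=\mathbb R^{2n}\to\mathbb C=\mathbb R^2$. A critical point of such a map is a point where the real differential has rank $<2$; a mixed singularity of $f^{-1}(\eta)$ is a critical point of $f$ lying on $f^{-1}(\eta)$. $V=f^{-1}(0)$; $B_r$ and $S_r$ are the closed ball and the sphere of radius $r$ centered at the origin of $\mathbb C^n$. For $I\subset\{1,\dots,n\}$: $\mathbb C^I=\{\mathbf z: z_j=0\ \forall j\notin I\}$, $\mathbb C^{*I}=\{\mathbf z\in\mathbb C^I: z_j\ne0\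 \forall j\in I\}$, $\mathbb C^{*n}=(\mathbb C\setminus\{0\})^n$, $f^I=f|_{\mathbb C^I}$, $I^c$ is the complement. $\mathcal I_{nv}(f)=\{I: f^I\not\equiv0\}$ and $\mathcal I_v(f)=\{I\neq\emptyset: f^I\equiv0\}$. For $I\in\mathcal I_v(f)$, $\mathbb C^I$ is called a vanishing coordinate subspace. Newton boundary: $\Gamma_+(f)$ is the convex hull of $\bigcup_{c_{\nu\mu}\ne0}(\nu+\mu+\mathbb R_{\ge0}^n)$, and $\Gamma(f)$ is the union of its compact faces. For a non-negative weight vector $P={}^t(p_1,\dots,p_n)$ let $d(P)$ be the minimum of $\xi\mapsto\sum p_i\xi_i$ on $\Gamma_+(f)$, $\Delta(P)$ the face where it is attained, and $I(P)=\{i: p_i=0\}$. A non-compact face $\Xi$ of $\Gamma_+(f)$ is essential if there is a non-negative weight $P$ with $\Delta(P)=\Xi$, $f^{I(P)}\equiv0$, and $\nu+\mathbb R_{\ge0}E_i\subset\Xi$ for all $i\in I(P)$, $\nu\in\Xi$ ($E_i$ the $i$-th unit vector). $I(P)$ depends only on $\Xi$ and is denoted $I(\Xi)$. $\Gamma_{nc}(f)$ is $\Gamma(f)$ together with all essential non-compact faces. For a face $\Delta$, $f_\Delta=\sum_{\nu+\mu\in\Delta}c_{\nu\mu}\mathbf z^\nu\bar{\mathbf z}^\mu$. $f$ is strongly non-degenerate if (i) for every compact face $\Delta\subset\Gamma_{nc}(f)$, $f_\Delta:\mathbb C^{*n}\to\mathbb C$ has no critical point, and (ii) for every non-compact face $\Delta\in\Gamma_{nc}(f)$,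 $f_{\Delta_0}:\mathbb C^{*n}\to\mathbb C$ has no critical point, where $\Delta_0=\Delta\cap\Gamma(f)$. Local tameness: for an essential non-compact face $\Delta$ put $\rho_\Delta(\mathbf z)=\sum_{j\in I(\Delta)}|z_j|^2$ and $V_\Delta^*=f_\Delta^{-1}(0)\cap\mathbb C^{*n}$. $f_\Delta$ is locally tame if there is $r_\Delta>0$ such that for any fixed nonzero values $z_j\ (j\in I(\Delta))$ with $\rho_\Delta(\mathbf z)\le r_\Delta^2$, $f_\Delta$, as a mixed polynomial function of the remaining variables $\{z_k: k\notin I(\Delta)\}$, has no critical points in $\mathbb C^{*I(\Delta)^c}$; moreover $r_\Delta$ is chosen (possible, after shrinking, because $f$ is a polynomial) so that $\rho_\Delta|_{V_\Delta^*}$ has no critical value in $(0,r_\Delta^2]$. $f$ is locally tame on $\mathbb C^I$ if every $f_\Delta$ with $\Delta$ essential non-compact and $I(\Delta)=I$ is locally tame; $f$ is locally tame along vanishing coordinate subspaces if this holds for every $I\in\mathcal I_v(f)$. Fixing such $r_\Delta$, put $r_I=\min\{r_\Delta: I(\Delta)=I\}$ and $r_{nc}=\min\{r_I: I\in\mathcal I_v(f)\}$ ($=+\infty$ if there are no such $I$). The number $r_0>0$ is fixed so that: for every $I\in\mathcal I_{nv}(f)$, $V\cap\mathbb C^{*I}$ is non-singular in $B_{r_0}$ and transverse to $S_r$ for all $0<r\le r_0$; $V^\sharp=\bigcup_{I\in\mathcal I_{nv}(f)}V\cap\mathbb C^{*I}$ is likewise non-singular in $B_{r_0}$; and there is $\delta>0$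 such that $f^{-1}(\eta)$ has no mixed singularity in $B_{r_0}$ for $0<|\eta|\le\delta$ (such $r_0$ exists for strongly non-degenerate $f$). *)

theory Defs
  imports "HOL-Analysis.Analysis" "HOL-Library.Poly_Mapping"
begin

section \<open>Mixed polynomials\<close>

text \<open>
  A mixed polynomial in the variables indexed by the finite type \<open>'n\<close>: the key
  \<open>(\<nu>, \<mu>)\<close> carries the coefficient of \<open>z\<^sup>\<nu> (cnj z)\<^sup>\<mu>\<close>.
\<close>

type_synonym 'n mixed_poly = "((nat ^ 'n) \<times> (nat ^ 'n)) \<Rightarrow>\<^sub>0 complex"

definition mixed_monom :: "(nat ^ 'n) \<times> (nat ^ 'n) \<Rightarrow> complex ^ 'n::finite \<Rightarrow> complex" where
  "mixed_monom k z = (\<Prod>i\<in>UNIV. (z $ i) ^ (fst k $ i) * (cnj (z $ i)) ^ (snd k $ i))"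

definition mixed_eval :: "'n::finite mixed_poly \<Rightarrow> complex ^ 'n \<Rightarrow> complex" where
  "mixed_eval f z = (\<Sum>k\<in>Poly_Mapping.keys f. Poly_Mapping.lookup f k * mixed_monom k z)"

definition exponent_sum :: "(nat ^ 'n) \<times> (nat ^ 'n) \<Rightarrow> real ^ 'n::finite" where
  "exponent_sum k = (\<chi> i. real (fst k $ i + snd k $ i))"

definition face_fun :: "'n::finite mixed_poly \<Rightarrow> (real ^ 'n) set \<Rightarrow> complex ^ 'n \<Rightarrow> complex" where
  "face_fun f \<Delta> z = (\<Sum>k\<in>{k \<in> Poly_Mapping.keys f. exponent_sum k \<in> \<Delta>}.
                       Poly_Mapping.lookup f k * mixed_monom k z)"


section \<open>Coordinate subspaces\<close>

definition coord_subspace :: "'n set \<Rightarrow> (complex ^ 'n::finite) set" where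
  "coord_subspace I = {z. \<forall>j. j \<notin> I \<longrightarrow> z $ j = 0}"

definition coord_torus :: "'n set \<Rightarrow> (complex ^ 'n::finite) set" where
  "coord_torus I = {z \<in> coord_subspace I. \<forall>j\<in>I. z $ j \<noteq> 0}"

definition nonvanishing_sets :: "'n::finite mixed_poly \<Rightarrow> 'n set set" where
  "nonvanishing_sets f = {I. \<exists>z\<in>coord_subspace I. mixed_eval f z \<noteq> 0}"

definition vanishing_sets :: "'n::finite mixed_poly \<Rightarrow> 'n set set" where
  "vanishing_sets f = {I. I \<noteq> {} \<and> (\<forall>z\<in>coord_subspace I. mixed_eval f z = 0)}"


section \<open>Critical points and transversality\<close>

text \<open>
  The set \<open>L\<close> is a linear subspace of directions.  For \<open>L = UNIV\<close> this is the usual notion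
  of a critical point of the real map \<open>F\<close>; for \<open>L = coord_subspace I\<close> it says that the
  differential of the function of the variables \<open>z\<^sub>j\<close>, \<open>j \<in> I\<close>, obtained from \<open>F\<close> by keeping
  the other coordinates of \<open>z\<close> fixed, has rank less than 2 (in particular, for
  \<open>z \<in> coord_subspace I\<close>, that \<open>z\<close> is critical for the restriction of \<open>F\<close> to that subspace).
\<close>

definition critical_along ::
    "(complex ^ 'n::finite) set \<Rightarrow> (complex ^ 'n \<Rightarrow> complex) \<Rightarrow> complex ^ 'n \<Rightarrow> bool" where
  "critical_along L F z \<longleftrightarrow> dim (frechet_derivative F (at z) ` L) < 2"

abbreviation critical_point :: "(complex ^ 'n::finite \<Rightarrow> complex) \<Rightarrow> complex ^ 'n \<Rightarrow> bool" where
  "critical_point \<equiv> critical_along UNIV"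

text \<open>The tangent space at \<open>z\<close> of the fibre of \<open>F\<close> restricted to \<open>L\<close>, when \<open>z\<close> is not critical.\<close>

definition fiber_tangent ::
    "(complex ^ 'n::finite) set \<Rightarrow> (complex ^ 'n \<Rightarrow> complex) \<Rightarrow> complex ^ 'n \<Rightarrow> (complex ^ 'n) set" where
  "fiber_tangent L F z = {v \<in> L. frechet_derivative F (at z) v = 0}"

definition sphere_tangent :: "complex ^ 'n::finite \<Rightarrow> (complex ^ 'n) set" where
  "sphere_tangent z = {v. v \<bullet> z = 0}"

text \<open>
  \<open>M\<close> is a (relatively open) part of a fibre of the restriction of \<open>F\<close> to \<open>L\<close>; it is required to be
  smooth at the points of intersection, and the two tangent spaces to span the whole real space.
\<close>

definition transverse_to_sphere ::
    "(complex ^ 'n::finite) set \<Rightarrow> (complex ^ 'n \<Rightarrow> complex) \<Rightarrow> (complex ^ 'n) set \<Rightarrow> real \<Rightarrow> bool" where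
  "transverse_to_sphere L F M r \<longleftrightarrow>
     (\<forall>z\<in>M \<inter> sphere 0 r.
        \<not> critical_along L F z \<and>
        {u + v | u v. u \<in> fiber_tangent L F z \<and> v \<in> sphere_tangent z} = UNIV)"


section \<open>Newton boundary\<close>

definition newton_polyhedron :: "'n::finite mixed_poly \<Rightarrow> (real ^ 'n) set" where
  "newton_polyhedron f =
     convex hull (\<Union>k\<in>Poly_Mapping.keys f. {exponent_sum k + x | x. \<forall>i. 0 \<le> x $ i})"

text \<open>The library's \<open>face_of\<close> admits the empty face, which is excluded here.\<close>

definition newton_face :: "'n::finite mixed_poly \<Rightarrow> (real ^ 'n) set \<Rightarrow> bool" where
  "newton_face f \<Delta> \<longleftrightarrow> \<Delta> face_of newton_polyhedron f \<and> \<Delta> \<noteq> {}"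

definition newton_boundary :: "'n::finite mixed_poly \<Rightarrow> (real ^ 'n) set" where
  "newton_boundary f = \<Union>{\<Delta>. newton_face f \<Delta> \<and> compact \<Delta>}"

definition weight_face :: "'n::finite mixed_poly \<Rightarrow> real ^ 'n \<Rightarrow> (real ^ 'n) set" where
  "weight_face f P =
     {\<xi> \<in> newton_polyhedron f. \<forall>\<xi>'\<in>newton_polyhedron f. P \<bullet> \<xi> \<le> P \<bullet> \<xi>'}"

definition weight_zeros :: "real ^ 'n::finite \<Rightarrow> 'n set" where
  "weight_zeros P = {i. P $ i = 0}"

definition essential_weight :: "'n::finite mixed_poly \<Rightarrow> (real ^ 'n) set \<Rightarrow> real ^ 'n \<Rightarrow> bool" where
  "essential_weight f \<Xi> P \<longleftrightarrow>
     (\<forall>i. 0 \<le> P $ i) \<and> weight_face f P = \<Xi> \<and>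
     (\<forall>z\<in>coord_subspace (weight_zeros P). mixed_eval f z = 0) \<and>
     (\<forall>i\<in>weight_zeros P. \<forall>\<nu>\<in>\<Xi>. \<forall>t\<ge>0. \<nu> + t *\<^sub>R axis i 1 \<in> \<Xi>)"

definition essential_face :: "'n::finite mixed_poly \<Rightarrow> (real ^ 'n) set \<Rightarrow> bool" where
  "essential_face f \<Xi> \<longleftrightarrow> newton_face f \<Xi> \<and> \<not> compact \<Xi> \<and> (\<exists>P. essential_weight f \<Xi> P)"

definition face_index :: "'n::finite mixed_poly \<Rightarrow> (real ^ 'n) set \<Rightarrow> 'n set" where
  "face_index f \<Xi> = (THE I. \<exists>P. essential_weight f \<Xi> P \<and> I = weight_zeros P)"

lemma weight_zeros_eq_directions:
  assumes "essential_weight f \<Xi> P" and "\<nu> \<in> \<Xi>"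
  shows "weight_zeros P = {i. \<forall>\<nu>\<in>\<Xi>. \<forall>t\<ge>0. \<nu> + t *\<^sub>R axis i 1 \<in> \<Xi>}"
proof (intro equalityI subsetI)
  fix i assume "i \<in> weight_zeros P"
  then show "i \<in> {i. \<forall>\<nu>\<in>\<Xi>. \<forall>t\<ge>0. \<nu> + t *\<^sub>R axis i 1 \<in> \<Xi>}"
    using assms(1) unfolding essential_weight_def by blast
next
  fix i assume "i \<in> {i. \<forall>\<nu>\<in>\<Xi>. \<forall>t\<ge>0. \<nu> + t *\<^sub>R axis i 1 \<in> \<Xi>}"
  then have "\<nu> + 1 *\<^sub>R axis i 1 \<in> \<Xi>"
    using assms(2) by (metis (mono_tags, lifting) mem_Collect_eq zero_le_one)
  moreover have face: "weight_face f P = \<Xi>" and pos: "0 \<le> P $ i"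
    using assms(1) unfolding essential_weight_def by blast+
  ultimately have "P \<bullet> (\<nu> + axis i 1) \<le> P \<bullet> \<nu>"
    using assms(2) unfolding weight_face_def by auto
  then have "P $ i \<le> 0"
    by (simp add: inner_add_right inner_axis)
  with pos show "i \<in> weight_zeros P"
    by (simp add: weight_zeros_def)
qed

lemma face_index_eq:
  assumes "essential_face f \<Xi>" and "essential_weight f \<Xi> P"
  shows "face_index f \<Xi> = weight_zeros P"
proof -
  obtain \<nu> where "\<nu> \<in> \<Xi>"
    using assms(1) unfolding essential_face_def newton_face_def by blast
  then show ?thesis
    unfolding face_index_def using assms(2)
    by (intro the_equality) (auto simp: weight_zeros_eq_directions)
qed

text \<open>The enlarged Newton boundary, as a family of faces.\<close>

definition newton_faces_nc :: "'n::finite mixed_poly \<Rightarrow> (real ^ 'n) set set" where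
  "newton_faces_nc f = {\<Delta>. newton_face f \<Delta> \<and> compact \<Delta>} \<union> {\<Delta>. essential_face f \<Delta>}"

definition strongly_nondegenerate :: "'n::finite mixed_poly \<Rightarrow> bool" where
  "strongly_nondegenerate f \<longleftrightarrow>
     (\<forall>\<Delta>\<in>newton_faces_nc f. compact \<Delta> \<longrightarrow>
        (\<forall>z\<in>coord_torus UNIV. \<not> critical_point (face_fun f \<Delta>) z)) \<and>
     (\<forall>\<Delta>\<in>newton_faces_nc f. \<not> compact \<Delta> \<longrightarrow>
        (\<forall>z\<in>coord_torus UNIV. \<not> critical_point (face_fun f (\<Delta> \<inter> newton_boundary f)) z))"


section \<open>Local tameness\<close>

definition rho_face :: "'n::finite mixed_poly \<Rightarrow> (real ^ 'n) set \<Rightarrow> complex ^ 'n \<Rightarrow> real" where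
  "rho_face f \<Delta> z = (\<Sum>j\<in>face_index f \<Delta>. (cmod (z $ j))\<^sup>2)"

definition tame_up_to :: "'n::finite mixed_poly \<Rightarrow> (real ^ 'n) set \<Rightarrow> real \<Rightarrow> bool" where
  "tame_up_to f \<Delta> r \<longleftrightarrow>
     (\<forall>z\<in>coord_torus UNIV. rho_face f \<Delta> z \<le> r\<^sup>2 \<longrightarrow>
        \<not> critical_along (coord_subspace (- face_index f \<Delta>)) (face_fun f \<Delta>) z)"

definition locally_tame_face :: "'n::finite mixed_poly \<Rightarrow> (real ^ 'n) set \<Rightarrow> bool" where
  "locally_tame_face f \<Delta> \<longleftrightarrow> (\<exists>r>0. tame_up_to f \<Delta> r)"

definition locally_tame_on :: "'n::finite mixed_poly \<Rightarrow> 'n set \<Rightarrow> bool" where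
  "locally_tame_on f I \<longleftrightarrow>
     (\<forall>\<Delta>. essential_face f \<Delta> \<and> face_index f \<Delta> = I \<longrightarrow> locally_tame_face f \<Delta>)"

definition locally_tame_along_vanishing :: "'n::finite mixed_poly \<Rightarrow> bool" where
  "locally_tame_along_vanishing f \<longleftrightarrow> (\<forall>I\<in>vanishing_sets f. locally_tame_on f I)"

text \<open>
  Critical values of \<open>rho_face f \<Delta>\<close> on the toric part of the zero set of \<open>face_fun f \<Delta>\<close>.
  When \<open>tame_up_to f \<Delta> r\<close> holds, that set is smooth wherever \<open>rho_face f \<Delta> \<le> r\<^sup>2\<close>, so there
  \<open>fiber_tangent\<close> is its tangent space.
\<close>

definition rho_critical_values :: "'n::finite mixed_poly \<Rightarrow> (real ^ 'n) set \<Rightarrow> real set" where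
  "rho_critical_values f \<Delta> =
     rho_face f \<Delta> ` {z \<in> coord_torus UNIV. face_fun f \<Delta> z = 0 \<and>
       (\<forall>v\<in>fiber_tangent UNIV (face_fun f \<Delta>) z. frechet_derivative (rho_face f \<Delta>) (at z) v = 0)}"

definition admissible_face_radius :: "'n::finite mixed_poly \<Rightarrow> (real ^ 'n) set \<Rightarrow> real \<Rightarrow> bool" where
  "admissible_face_radius f \<Delta> r \<longleftrightarrow>
     0 < r \<and> tame_up_to f \<Delta> r \<and> rho_critical_values f \<Delta> \<inter> {0<..r\<^sup>2} = {}"

text \<open>
  The minima below run over finite families; infima in \<open>ereal\<close> give the value \<open>\<infinity>\<close>
  when the family is empty.
\<close>

definition r_subspace :: "'n::finite mixed_poly \<Rightarrow> ((real ^ 'n) set \<Rightarrow> real) \<Rightarrow> 'n set \<Rightarrow> ereal" where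
  "r_subspace f r\<^sub>\<Delta> I = (INF \<Delta>\<in>{\<Delta>. essential_face f \<Delta> \<and> face_index f \<Delta> = I}. ereal (r\<^sub>\<Delta> \<Delta>))"

definition r_nc :: "'n::finite mixed_poly \<Rightarrow> ((real ^ 'n) set \<Rightarrow> real) \<Rightarrow> ereal" where
  "r_nc f r\<^sub>\<Delta> = (INF I\<in>vanishing_sets f. r_subspace f r\<^sub>\<Delta> I)"


section \<open>The radius \<open>r\<^sub>0\<close>\<close>

definition no_mixed_singularity_in :: "'n::finite mixed_poly \<Rightarrow> complex \<Rightarrow> (complex ^ 'n) set \<Rightarrow> bool" where
  "no_mixed_singularity_in f \<eta> B \<longleftrightarrow>
     (\<forall>z\<in>B. mixed_eval f z = \<eta> \<longrightarrow> \<not> critical_point (mixed_eval f) z)"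

definition V_torus :: "'n::finite mixed_poly \<Rightarrow> 'n set \<Rightarrow> (complex ^ 'n) set" where
  "V_torus f I = mixed_eval f -` {0} \<inter> coord_torus I"

definition V_sharp :: "'n::finite mixed_poly \<Rightarrow> (complex ^ 'n) set" where
  "V_sharp f = (\<Union>I\<in>nonvanishing_sets f. V_torus f I)"

definition admissible_ball_radius :: "'n::finite mixed_poly \<Rightarrow> real \<Rightarrow> bool" where
  "admissible_ball_radius f r\<^sub>0 \<longleftrightarrow>
     0 < r\<^sub>0 \<and>
     (\<forall>I\<in>nonvanishing_sets f.
        (\<forall>z\<in>V_torus f I \<inter> cball 0 r\<^sub>0. \<not> critical_along (coord_subspace I) (mixed_eval f) z) \<and>
        (\<forall>r. 0 < r \<and> r \<le> r\<^sub>0 \<longrightarrow>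
           transverse_to_sphere (coord_subspace I) (mixed_eval f) (V_torus f I) r)) \<and>
     (\<forall>z\<in>V_sharp f \<inter> cball 0 r\<^sub>0. \<not> critical_point (mixed_eval f) z) \<and>
     (\<exists>\<delta>>0. \<forall>\<eta>. 0 < cmod \<eta> \<and> cmod \<eta> \<le> \<delta> \<longrightarrow> no_mixed_singularity_in f \<eta> (cball 0 r\<^sub>0))"

definition rho_zero :: "'n::finite mixed_poly \<Rightarrow> ((real ^ 'n) set \<Rightarrow> real) \<Rightarrow> real \<Rightarrow> real" where
  "rho_zero f r\<^sub>\<Delta> r\<^sub>0 = real_of_ereal (min (r_nc f r\<^sub>\<Delta>) (ereal r\<^sub>0))"

end

theory Submission
  imports Defs
begin

text \<open>
  The first assertion is part of the choice of \<open>r\<^sub>0\<close>, because \<open>rho_zero f r\<^sub>\<Delta> r\<^sub>0 \<le> r\<^sub>0\<close>.  For the second,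
  suppose that transversality fails on nearby fibers arbitrarily close to the zero fiber.  At such a
  point \<open>z\<close> of a smooth fiber the tangent space of the fiber lies in that of the sphere, which means
  that there is a Lagrange multiplier \<open>lam\<close> with \<open>z \<bullet> v = lam \<bullet> df\<^sub>z(v)\<close> for all \<open>v\<close>
  (\<open>nontransverse_multiplier\<close>).  By compactness of the shell between the radii \<open>r\<^sub>1\<close> and \<open>rho_zero\<close> a
  sequence of such points converges to some \<open>z0 \<noteq> 0\<close> with \<open>f(z0) = 0\<close>.  Let \<open>J\<close> be the set of
  coordinates that do not vanish at \<open>z0\<close>.

  If \<open>f\<close> does not vanish identically on the coordinate subspace of \<open>J\<close>, then the zero fiber in that
  subspace is transverse at \<open>z0\<close> to the sphere through \<open>z0\<close>, and transversality is an open condition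
  (\<open>transverse_limit_excludes_multipliers\<close>).

  If \<open>f\<close> vanishes identically there, local tameness enters
  (\<open>tame_face_excludes_multipliers\<close>).  Instead of selecting an analytic curve of bad points
  one can work with the sequence itself.  The negative logarithms of the absolute values of the
  coordinates tending to \<open>0\<close> form a sequence of weights; up to a convergent error
  these weights select one face of the Newton polyhedron, by linear algebra
  on the finitely many exponents (\<open>weight_extraction\<close>, \<open>toric_rescaling\<close>).  This face is essential with
  index set \<open>J\<close>, and after rescaling the coordinates by the weights \<open>f\<close> converges, with its differential,
  to the face function.  Tameness says that the differential of the face function is already
  onto in the directions outside \<open>J\<close>.  These directions are contracted by the rescaling, so the
  multiplier equation forces the rescaled multipliers to tend to \<open>0\<close>; the vector \<open>z0\<close> is not
  contracted, and on it the same equation gives \<open>z0 \<bullet> z0 = 0\<close>, a contradiction.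
\<close>

section \<open>Lagrange multipliers\<close>

lemma noncritical_along_surj:
  fixes F :: "complex ^ 'n::finite \<Rightarrow> complex"
  assumes "\<not> critical_along L F z" "F differentiable at z" "subspace L"
  obtains v where "v \<in> L" "frechet_derivative F (at z) v = c"
proof -
  let ?D = "frechet_derivative F (at z)"
  have "linear ?D"
    using assms(2) by (rule linear_frechet_derivative)
  then have sub: "subspace (?D ` L)"
    using assms(3) by (rule linear_subspace_image)
  have "dim (?D ` L) = DIM(complex)"
    using assms(1) dim_subset_UNIV[of "?D ` L"] unfolding critical_along_def by simp
  then have "?D ` L = UNIV"
    using sub dim_eq_full[of "?D ` L"] span_eq_iff[of "?D ` L"] by simp
  then have "c \<in> ?D ` L" by simp
  then show thesis
    using that by blast
qed

text \<open>
  Linear duality: if the kernel of a surjective map to the plane lies in the hyperplane orthogonal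
  to \<open>z\<close>, then the functional \<open>v \<mapsto> z \<bullet> v\<close> factors through that map, and \<open>lam\<close> is the Lagrange
  multiplier representing the factor.
\<close>

lemma nontransverse_multiplier:
  fixes F :: "complex ^ 'n::finite \<Rightarrow> complex"
  assumes diff: "F differentiable at z" and nc: "\<not> critical_point F z"
    and nt: "{u + v | u v. u \<in> fiber_tangent UNIV F z \<and> v \<in> sphere_tangent z} \<noteq> UNIV"
  obtains lam where "\<And>v. z \<bullet> v = lam \<bullet> frechet_derivative F (at z) v"
proof -
  let ?D = "frechet_derivative F (at z)"
  have lin: "linear ?D"
    using diff by (rule linear_frechet_derivative)
  have ker: "z \<bullet> k = 0" if k: "?D k = 0" for k
  proof (rule ccontr)
    assume nz: "z \<bullet> k \<noteq> 0"
    have "x \<in> {u + v | u v. u \<in> fiber_tangent UNIV F z \<and> v \<in> sphere_tangent z}" for x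
    proof -
      let ?u = "((x \<bullet> z) / (z \<bullet> k)) *\<^sub>R k"
      have "?u \<in> fiber_tangent UNIV F z"
        using k lin by (simp add: fiber_tangent_def linear_scale)
      moreover have "x - ?u \<in> sphere_tangent z"
        using nz by (simp add: sphere_tangent_def inner_diff_left inner_commute[of k z])
      ultimately show ?thesis
        by (intro CollectI exI[of _ ?u] exI[of _ "x - ?u"]) simp
    qed
    with nt show False by blast
  qed
  obtain v1 where v1: "?D v1 = 1"
    using noncritical_along_surj[OF nc diff subspace_UNIV] by blast
  obtain v2 where v2: "?D v2 = \<i>"
    using noncritical_along_surj[OF nc diff subspace_UNIV] by blast
  have "z \<bullet> v = Complex (z \<bullet> v1) (z \<bullet> v2) \<bullet> ?D v" for v
  proof -
    let ?k = "v - (Re (?D v) *\<^sub>R v1 + Im (?D v) *\<^sub>R v2)"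
    have "?D ?k = 0"
      using lin by (simp add: linear_diff linear_add linear_scale v1 v2 complex_eq_iff)
    from ker[OF this] show ?thesis
      by (simp add: inner_diff_right inner_add_right inner_complex_def algebra_simps)
  qed
  then show thesis by (rule that)
qed

text \<open>
  A multiplier is determined by its pairings with two vectors near the basis \<open>1, \<i>\<close>, and depends on
  them continuously by Cramer's rule.  This is how surjectivity of a limit differential gives
  control over the multipliers along a sequence.
\<close>

lemma multiplier_tendsto:
  fixes lam X Y :: "nat \<Rightarrow> complex"
  assumes X: "X \<longlonglongrightarrow> 1" and Y: "Y \<longlonglongrightarrow> \<i>"
    and "(\<lambda>n. lam n \<bullet> X n) \<longlonglongrightarrow> \<alpha>" and "(\<lambda>n. lam n \<bullet> Y n) \<longlonglongrightarrow> \<beta>"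
  shows "lam \<longlonglongrightarrow> Complex \<alpha> \<beta>"
proof -
  \<comment> \<open>\<open>d\<close> is the determinant of the linear system for \<open>lam\<close>, and \<open>c\<close> its solution by Cramer's rule.\<close>
  define d where "d n = Re (X n) * Im (Y n) - Im (X n) * Re (Y n)" for n
  have xr: "(\<lambda>n. Re (X n)) \<longlonglongrightarrow> 1" and xi: "(\<lambda>n. Im (X n)) \<longlonglongrightarrow> 0"
    and yr: "(\<lambda>n. Re (Y n)) \<longlonglongrightarrow> 0" and yi: "(\<lambda>n. Im (Y n)) \<longlonglongrightarrow> 1"
    using tendsto_Re[OF X] tendsto_Im[OF X] tendsto_Re[OF Y] tendsto_Im[OF Y] by simp_all
  have d: "d \<longlonglongrightarrow> 1"
    unfolding d_def using tendsto_diff[OF tendsto_mult[OF xr yi] tendsto_mult[OF xi yr]] by simp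
  then have ev: "eventually (\<lambda>n. d n \<noteq> 0) sequentially"
    by (rule tendsto_imp_eventually_ne) simp
  define c where "c n = Complex (((lam n \<bullet> X n) * Im (Y n) - (lam n \<bullet> Y n) * Im (X n)) / d n)
                     (((lam n \<bullet> Y n) * Re (X n) - (lam n \<bullet> X n) * Re (Y n)) / d n)" for n
  have "c \<longlonglongrightarrow> Complex ((\<alpha> * 1 - \<beta> * 0) / 1) ((\<beta> * 1 - \<alpha> * 0) / 1)"
    unfolding c_def
    by (rule tendsto_Complex[OF
          tendsto_divide[OF tendsto_diff[OF tendsto_mult[OF assms(3) yi] tendsto_mult[OF assms(4) xi]] d]
          tendsto_divide[OF tendsto_diff[OF tendsto_mult[OF assms(4) xr] tendsto_mult[OF assms(3) yr]] d]])
       simp_all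
  moreover have "eventually (\<lambda>n. c n = lam n) sequentially"
    using ev
  proof eventually_elim
    case (elim n)
    have "(lam n \<bullet> X n) * Im (Y n) - (lam n \<bullet> Y n) * Im (X n) = Re (lam n) * d n"
         "(lam n \<bullet> Y n) * Re (X n) - (lam n \<bullet> X n) * Re (Y n) = Im (lam n) * d n"
      by (simp_all add: d_def inner_complex_def algebra_simps)
    then show ?case
      using elim by (simp add: c_def)
  qed
  ultimately show ?thesis
    using Lim_transform_eventually by fastforce
qed

section \<open>Differentials of mixed polynomials\<close>

text \<open>
  Continuity in the base point cannot be read off from \<open>frechet_derivative\<close>, which is defined by choice;
  the product rule gives a formula that is visibly continuous.
\<close>

lemma mixed_monom_C1:
  obtains m' :: "complex ^ 'n::finite \<Rightarrow> complex ^ 'n \<Rightarrow> complex"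
  where "\<And>z. (mixed_monom k has_derivative m' z) (at z)" "\<And>v. continuous_on UNIV (\<lambda>z. m' z v)"
proof -
  define g where "g i z = (z $ i) ^ (fst k $ i) * (cnj (z $ i)) ^ (snd k $ i)"
    for i and z :: "complex ^ 'n"
  define g' where "g' i z v =
      (z $ i) ^ (fst k $ i) * (of_nat (snd k $ i) * cnj (v $ i) * (cnj (z $ i)) ^ (snd k $ i - 1)) +
      (of_nat (fst k $ i) * (v $ i) * (z $ i) ^ (fst k $ i - 1)) * (cnj (z $ i)) ^ (snd k $ i)"
    for i and z v :: "complex ^ 'n"
  have c: "((\<lambda>z :: complex ^ 'n. z $ i) has_derivative (\<lambda>v. v $ i)) (at z)" for i z
    by (rule bounded_linear_imp_has_derivative[OF bounded_linear_vec_nth])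
  have cc: "((\<lambda>z :: complex ^ 'n. cnj (z $ i)) has_derivative (\<lambda>v. cnj (v $ i))) (at z)" for i z
    by (rule bounded_linear.has_derivative[OF bounded_linear_cnj c])
  have g: "(g i has_derivative g' i z) (at z)" for i z
    unfolding g_def[abs_def] g'_def
    by (rule has_derivative_eq_rhs,
        rule has_derivative_mult[OF has_derivative_power[OF c] has_derivative_power[OF cc]]) simp
  have "(mixed_monom k has_derivative (\<lambda>v. \<Sum>i\<in>UNIV. g' i z v * (\<Prod>j\<in>UNIV - {i}. g j z))) (at z)" for z
  proof -
    have "mixed_monom k = (\<lambda>z. \<Prod>i\<in>UNIV. g i z)"
      by (simp add: mixed_monom_def g_def fun_eq_iff)
    then show ?thesis
      using has_derivative_prod[of UNIV g "\<lambda>i. g' i z" z UNIV] g by simp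
  qed
  moreover have "continuous_on UNIV (\<lambda>z. \<Sum>i\<in>UNIV. g' i z v * (\<Prod>j\<in>UNIV - {i}. g j z))" for v
    unfolding g_def g'_def by (intro continuous_intros)
  ultimately show thesis by (rule that)
qed

lemma mixed_monom_has_derivative:
  "(mixed_monom k has_derivative frechet_derivative (mixed_monom k) (at z)) (at z)"
proof -
  obtain m' where "\<And>z. (mixed_monom k has_derivative m' z) (at z)"
    by (rule mixed_monom_C1) blast
  then have "mixed_monom k differentiable at z"
    by (rule differentiableI)
  then show ?thesis
    by (simp add: frechet_derivative_works)
qed

lemma continuous_mixed_monom_derivative:
  "continuous_on UNIV (\<lambda>z. frechet_derivative (mixed_monom k) (at z) v)"
proof -
  obtain m' where m': "\<And>z. (mixed_monom k has_derivative m' z) (at z)"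
      "\<And>v. continuous_on UNIV (\<lambda>z. m' z v)"
    by (rule mixed_monom_C1) blast
  have "frechet_derivative (mixed_monom k) (at z) = m' z" for z
    using m'(1) by (rule frechet_derivative_at[symmetric])
  with m'(2) show ?thesis by simp
qed

lemma monomial_sum_has_derivative:
  "((\<lambda>z. \<Sum>k\<in>S. c k * mixed_monom k z) has_derivative
     (\<lambda>v. \<Sum>k\<in>S. c k * frechet_derivative (mixed_monom k) (at z) v)) (at z)"
  by (intro has_derivative_sum has_derivative_mult_right mixed_monom_has_derivative)

lemma mixed_eval_has_derivative:
  "(mixed_eval f has_derivative
     (\<lambda>v. \<Sum>k\<in>Poly_Mapping.keys f. Poly_Mapping.lookup f k * frechet_derivative (mixed_monom k) (at z) v)) (at z)"
  unfolding mixed_eval_def[abs_def] by (rule monomial_sum_has_derivative)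

lemma face_fun_has_derivative:
  "(face_fun f \<Delta> has_derivative
     (\<lambda>v. \<Sum>k\<in>{k \<in> Poly_Mapping.keys f. exponent_sum k \<in> \<Delta>}.
        Poly_Mapping.lookup f k * frechet_derivative (mixed_monom k) (at z) v)) (at z)"
  unfolding face_fun_def[abs_def] by (rule monomial_sum_has_derivative)

lemmas mixed_eval_derivative = frechet_derivative_at[OF mixed_eval_has_derivative, symmetric]
lemmas face_fun_derivative = frechet_derivative_at[OF face_fun_has_derivative, symmetric]

lemma differentiable_mixed_eval: "mixed_eval f differentiable at z"
  using mixed_eval_has_derivative by (rule differentiableI)

lemma differentiable_face_fun: "face_fun f \<Delta> differentiable at z"
  using face_fun_has_derivative by (rule differentiableI)

lemma tendsto_mixed_monom_derivative:
  assumes "a \<longlonglongrightarrow> b"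
  shows "(\<lambda>n. frechet_derivative (mixed_monom k) (at (a n)) v)
           \<longlonglongrightarrow> frechet_derivative (mixed_monom k) (at b) v"
  using continuous_on_tendsto_compose[OF continuous_mixed_monom_derivative assms] by simp

text \<open>
  The exponent carries a minus sign because the weights below arise as \<open>- ln (cmod (z $ i))\<close>: a
  large positive weight means a small coordinate.
\<close>

definition torus_scale :: "real ^ 'n::finite \<Rightarrow> complex ^ 'n \<Rightarrow> complex ^ 'n" where
  "torus_scale p z = (\<chi> i. of_real (exp (- (p $ i))) * z $ i)"

lemma bounded_linear_torus_scale: "bounded_linear (torus_scale p)"
proof -
  have "linear (torus_scale p)"
    by (rule linearI) (auto simp: torus_scale_def vec_eq_iff algebra_simps)
  then show ?thesis by (simp add: linear_conv_bounded_linear)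
qed

lemma mixed_monom_torus_scale:
  "mixed_monom k (torus_scale p z) = of_real (exp (- (p \<bullet> exponent_sum k))) * mixed_monom k z"
proof -
  have "mixed_monom k (torus_scale p z) =
      (\<Prod>i\<in>UNIV. of_real (exp (- (p $ i))) ^ (fst k $ i + snd k $ i)) * mixed_monom k z"
    unfolding mixed_monom_def prod.distrib[symmetric]
    by (intro prod.cong refl) (simp add: torus_scale_def power_mult_distrib power_add algebra_simps)
  also have "(\<Prod>i\<in>UNIV. (of_real (exp (- (p $ i))) :: complex) ^ (fst k $ i + snd k $ i))
      = of_real (\<Prod>i\<in>UNIV. exp (- (p $ i * exponent_sum k $ i)))"
    unfolding of_real_prod
    by (intro prod.cong refl)
       (simp add: exponent_sum_def flip: exp_of_nat_mult of_real_power of_nat_add exp_minus)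
  also have "(\<Prod>i\<in>UNIV. exp (- (p $ i * exponent_sum k $ i))) = exp (- (p \<bullet> exponent_sum k))"
    by (simp add: inner_vec_def exp_sum sum_negf[symmetric])
  finally show ?thesis .
qed

text \<open>
  Differentiating the homogeneity of a monomial: rescaling base point and tangent vector together
  multiplies the differential by the same factor as the value, so no powers of single coordinates
  have to be tracked.
\<close>

lemma mixed_monom_derivative_torus_scale:
  "frechet_derivative (mixed_monom k) (at (torus_scale p z)) (torus_scale p v) =
     of_real (exp (- (p \<bullet> exponent_sum k))) * frechet_derivative (mixed_monom k) (at z) v"
proof -
  have "((\<lambda>z. mixed_monom k (torus_scale p z)) has_derivative
      (\<lambda>v. frechet_derivative (mixed_monom k) (at (torus_scale p z)) (torus_scale p v))) (at z)"
    by (rule has_derivative_compose[OF bounded_linear_imp_has_derivative[OF bounded_linear_torus_scale]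
          mixed_monom_has_derivative])
  moreover have "((\<lambda>z. mixed_monom k (torus_scale p z)) has_derivative
      (\<lambda>v. of_real (exp (- (p \<bullet> exponent_sum k))) * frechet_derivative (mixed_monom k) (at z) v)) (at z)"
    unfolding mixed_monom_torus_scale
    by (intro has_derivative_mult_right mixed_monom_has_derivative)
  ultimately have "(\<lambda>v. frechet_derivative (mixed_monom k) (at (torus_scale p z)) (torus_scale p v)) =
      (\<lambda>v. of_real (exp (- (p \<bullet> exponent_sum k))) * frechet_derivative (mixed_monom k) (at z) v)"
    by (rule has_derivative_unique)
  then show ?thesis by (rule fun_cong)
qed

section \<open>Faces of the Newton polyhedron\<close>

lemma newton_polyhedron_exponent:
  assumes "k \<in> Poly_Mapping.keys f"
  shows "exponent_sum k \<in> newton_polyhedron f"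
proof -
  have "exponent_sum k \<in> {exponent_sum k + x | x. \<forall>i. 0 \<le> x $ i}"
    by (intro CollectI exI[of _ 0]) simp
  with assms show ?thesis
    unfolding newton_polyhedron_def by (intro hull_inc) blast
qed

lemma newton_polyhedron_add_axis:
  assumes "\<xi> \<in> newton_polyhedron f" and "0 \<le> t"
  shows "\<xi> + t *\<^sub>R axis i 1 \<in> newton_polyhedron f"
proof -
  let ?U = "\<Union>k\<in>Poly_Mapping.keys f. {exponent_sum k + x | x. \<forall>i. 0 \<le> x $ i}"
  have "?U \<subseteq> {\<xi>. \<xi> + t *\<^sub>R axis i 1 \<in> newton_polyhedron f}"
  proof
    fix \<xi> assume "\<xi> \<in> ?U"
    then obtain k x where k: "k \<in> Poly_Mapping.keys f" and x: "\<forall>i. 0 \<le> x $ i"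
        and \<xi>: "\<xi> = exponent_sum k + x"
      by blast
    have "\<forall>j. 0 \<le> (x + t *\<^sub>R axis i 1) $ j"
      using x assms(2) by (simp add: axis_def)
    then have "\<xi> + t *\<^sub>R axis i 1 \<in> {exponent_sum k + x | x. \<forall>i. 0 \<le> x $ i}"
      using \<xi> by (intro CollectI exI[of _ "x + t *\<^sub>R axis i 1"]) (simp add: add.assoc)
    with k show "\<xi> \<in> {\<xi>. \<xi> + t *\<^sub>R axis i 1 \<in> newton_polyhedron f}"
      unfolding newton_polyhedron_def by (intro CollectI hull_inc) blast
  qed
  moreover have "convex {\<xi>. \<xi> + t *\<^sub>R axis i 1 \<in> newton_polyhedron f}"
  proof -
    have "{\<xi>. \<xi> + t *\<^sub>R axis i 1 \<in> newton_polyhedron f}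
        = (\<lambda>\<xi>. - (t *\<^sub>R axis i 1) + \<xi>) ` newton_polyhedron f"
      by (auto simp: image_iff algebra_simps intro!: bexI[of _ "_ + t *\<^sub>R axis i 1"])
    then show ?thesis
      by (simp add: newton_polyhedron_def convex_translation)
  qed
  ultimately have "newton_polyhedron f \<subseteq> {\<xi>. \<xi> + t *\<^sub>R axis i 1 \<in> newton_polyhedron f}"
    by (subst newton_polyhedron_def) (rule hull_minimal)
  with assms(1) show ?thesis by blast
qed

lemma weight_face_eq:
  fixes P :: "real ^ 'n::finite"
  assumes pos: "\<And>i. 0 \<le> P $ i" and k0: "k0 \<in> Poly_Mapping.keys f"
    and min: "\<And>k. k \<in> Poly_Mapping.keys f \<Longrightarrow> P \<bullet> exponent_sum k0 \<le> P \<bullet> exponent_sum k"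
  shows "weight_face f P = newton_polyhedron f \<inter> {\<xi>. P \<bullet> \<xi> = P \<bullet> exponent_sum k0}"
    and "\<And>\<xi>. \<xi> \<in> newton_polyhedron f \<Longrightarrow> P \<bullet> exponent_sum k0 \<le> P \<bullet> \<xi>"
proof -
  have "newton_polyhedron f \<subseteq> {\<xi>. P \<bullet> \<xi> \<ge> P \<bullet> exponent_sum k0}"
    unfolding newton_polyhedron_def
  proof (rule hull_minimal)
    have "P \<bullet> exponent_sum k0 \<le> P \<bullet> (exponent_sum k + x)"
      if "k \<in> Poly_Mapping.keys f" "\<forall>i. 0 \<le> x $ i" for k x
    proof -
      have "0 \<le> P \<bullet> x"
        using that(2) pos by (simp add: inner_vec_def sum_nonneg)
      with min[OF that(1)] show ?thesis
        by (simp add: inner_add_right)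
    qed
    then show "(\<Union>k\<in>Poly_Mapping.keys f. {exponent_sum k + x | x. \<forall>i. 0 \<le> x $ i})
        \<subseteq> {\<xi>. P \<bullet> exponent_sum k0 \<le> P \<bullet> \<xi>}"
      by blast
    show "convex {\<xi>. P \<bullet> exponent_sum k0 \<le> P \<bullet> \<xi>}"
      using convex_halfspace_ge[of "P \<bullet> exponent_sum k0" P] by simp
  qed
  then show ge: "\<And>\<xi>. \<xi> \<in> newton_polyhedron f \<Longrightarrow> P \<bullet> exponent_sum k0 \<le> P \<bullet> \<xi>"
    by blast
  show "weight_face f P = newton_polyhedron f \<inter> {\<xi>. P \<bullet> \<xi> = P \<bullet> exponent_sum k0}"
  proof (intro equalityI subsetI)
    fix \<xi> assume "\<xi> \<in> weight_face f P"
    then show "\<xi> \<in> newton_polyhedron f \<inter> {\<xi>. P \<bullet> \<xi> = P \<bullet> exponent_sum k0}"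
      using newton_polyhedron_exponent[OF k0] ge[of \<xi>] unfolding weight_face_def by force
  next
    fix \<xi> assume "\<xi> \<in> newton_polyhedron f \<inter> {\<xi>. P \<bullet> \<xi> = P \<bullet> exponent_sum k0}"
    then show "\<xi> \<in> weight_face f P"
      using ge unfolding weight_face_def by force
  qed
qed

text \<open>
  The rays in the directions \<open>i\<close> with \<open>P $ i = 0\<close> stay in the face of \<open>P\<close>, which makes the face both
  unbounded and invariant in these directions.
\<close>

lemma essential_weight_face:
  fixes P :: "real ^ 'n::finite"
  assumes pos: "\<And>i. 0 \<le> P $ i" and k0: "k0 \<in> Poly_Mapping.keys f"
    and min: "\<And>k. k \<in> Poly_Mapping.keys f \<Longrightarrow> P \<bullet> exponent_sum k0 \<le> P \<bullet> exponent_sum k"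
    and I: "weight_zeros P \<in> vanishing_sets f"
  shows "essential_face f (weight_face f P)" and "face_index f (weight_face f P) = weight_zeros P"
proof -
  let ?\<Delta> = "weight_face f P"
  have eq: "?\<Delta> = newton_polyhedron f \<inter> {\<xi>. P \<bullet> \<xi> = P \<bullet> exponent_sum k0}"
    and ge: "\<And>\<xi>. \<xi> \<in> newton_polyhedron f \<Longrightarrow> P \<bullet> exponent_sum k0 \<le> P \<bullet> \<xi>"
    using weight_face_eq[of P k0 f] pos k0 min by blast+
  have k0\<Delta>: "exponent_sum k0 \<in> ?\<Delta>"
    using newton_polyhedron_exponent[OF k0] eq by simp
  have ray: "\<xi> + t *\<^sub>R axis i 1 \<in> ?\<Delta>" if "i \<in> weight_zeros P" "\<xi> \<in> ?\<Delta>" "0 \<le> t" for i \<xi> t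
    using that newton_polyhedron_add_axis[of \<xi> f t i]
    by (simp add: eq weight_zeros_def inner_add_right inner_axis)
  have "newton_face f ?\<Delta>"
  proof -
    have "convex (newton_polyhedron f)"
      by (simp add: newton_polyhedron_def)
    from face_of_Int_supporting_hyperplane_ge[OF this ge] k0\<Delta> show ?thesis
      unfolding newton_face_def by (auto simp: eq)
  qed
  moreover have "\<not> compact ?\<Delta>"
  proof
    assume "compact ?\<Delta>"
    then have "bounded ?\<Delta>"
      by (rule compact_imp_bounded)
    then obtain B where "\<forall>\<xi>\<in>?\<Delta>. norm \<xi> \<le> B"
      unfolding bounded_iff ..
    then have B: "\<And>\<xi>. \<xi> \<in> ?\<Delta> \<Longrightarrow> norm \<xi> \<le> B"
      by blast
    obtain i where i: "i \<in> weight_zeros P"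
      using I unfolding vanishing_sets_def by blast
    have "0 \<le> B"
      using B[OF k0\<Delta>] norm_ge_zero order_trans by blast
    have "norm (exponent_sum k0 + (B + 1) *\<^sub>R axis i 1) \<le> B"
      using \<open>0 \<le> B\<close> by (intro B ray i k0\<Delta>) simp
    moreover have "(exponent_sum k0 + (B + 1) *\<^sub>R axis i 1) $ i \<ge> B + 1"
      by (simp add: exponent_sum_def)
    ultimately show False
      using component_le_norm_cart[of "exponent_sum k0 + (B + 1) *\<^sub>R axis i 1" i] by linarith
  qed
  moreover have ew: "essential_weight f ?\<Delta> P"
    using pos I ray unfolding essential_weight_def vanishing_sets_def by blast
  ultimately show "essential_face f ?\<Delta>"
    unfolding essential_face_def by blast
  from this ew show "face_index f ?\<Delta> = weight_zeros P"
    by (rule face_index_eq)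
qed

section \<open>Selecting a face by a sequence of weights\<close>

lemma convergent_common_subseq:
  fixes g :: "'a \<Rightarrow> nat \<Rightarrow> real"
  assumes "finite E" and "\<And>e n. e \<in> E \<Longrightarrow> \<bar>g e n\<bar> \<le> 1"
  shows "\<exists>r. strict_mono r \<and> (\<forall>e\<in>E. convergent (\<lambda>n. g e (r n)))"
  using assms
proof (induction E rule: finite_induct)
  case empty
  show ?case
    by (intro exI[of _ id]) (simp add: strict_mono_def)
next
  case (insert x E)
  then obtain r where r: "strict_mono r" "\<And>e. e \<in> E \<Longrightarrow> convergent (\<lambda>n. g e (r n))"
    by (metis insertCI)
  have "bounded (range (\<lambda>n. g x (r n)))"
    using insert.prems by (auto simp: bounded_iff intro!: exI[of _ 1])
  then obtain l r' where r': "strict_mono r'" "((\<lambda>n. g x (r n)) \<circ> r') \<longlonglongrightarrow> l"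
    using bounded_imp_convergent_subsequence by blast
  have "convergent (\<lambda>n. g e ((r \<circ> r') n))" if "e \<in> insert x E" for e
  proof (cases "e = x")
    case True
    with r'(2) show ?thesis
      by (auto simp: o_def convergent_def)
  next
    case False
    with that r(2) have "convergent (\<lambda>n. g e (r n))" by blast
    from convergent_subseq_convergent[OF this r'(1)] show ?thesis
      by (simp add: o_def)
  qed
  with strict_mono_o[OF r(1) r'(1)] show ?case by blast
qed

text \<open>
  Take for \<open>u n\<close> the orthogonal projection of \<open>w n\<close> to the span of \<open>F\<close>: its coordinates in an
  orthonormal basis are linear combinations of the convergent pairings.
\<close>

lemma projection_part_convergent:
  fixes w :: "nat \<Rightarrow> 'a::euclidean_space"
  assumes "\<And>q. q \<in> F \<Longrightarrow> convergent (\<lambda>n. w n \<bullet> q)"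
  obtains u where "convergent u" "\<And>n q. q \<in> F \<Longrightarrow> u n \<bullet> q = w n \<bullet> q"
proof -
  have span: "convergent (\<lambda>n. w n \<bullet> q)" if "q \<in> span F" for q
    using that
  proof (induction rule: span_induct)
    case base
    show ?case
      unfolding subspace_def mem_Collect_eq
      by (auto simp: inner_add_right intro!: convergent_const convergent_add convergent_mult)
  next
    case (step x)
    with assms show ?case by simp
  qed
  obtain B where B: "B \<subseteq> span F" "pairwise orthogonal B" "\<And>x. x \<in> B \<Longrightarrow> norm x = 1"
      "independent B" "span B = span F"
    using orthonormal_basis_subspace[OF subspace_span[of F]] by metis
  have fin: "finite B"
    using B(4) by (rule independent_imp_finite)
  define u where "u n = (\<Sum>b\<in>B. (w n \<bullet> b) *\<^sub>R b)" for n
  show thesis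
  proof
    show "convergent u"
      unfolding u_def
    proof (rule convergent_sum)
      fix b assume "b \<in> B"
      then obtain l where "(\<lambda>n. w n \<bullet> b) \<longlonglongrightarrow> l"
        using span B(1) unfolding convergent_def by blast
      then show "convergent (\<lambda>n. (w n \<bullet> b) *\<^sub>R b)"
        by (intro convergentI) (rule tendsto_scaleR[OF _ tendsto_const])
    qed
    fix n q assume "q \<in> F"
    then have "q \<in> span B"
      using B(5) span_base by blast
    then show "u n \<bullet> q = w n \<bullet> q"
    proof (induction rule: span_induct)
      case base
      show ?case
        unfolding subspace_def by (auto simp: inner_add_right)
    next
      case (step x)
      have "(w n \<bullet> b) *\<^sub>R b \<bullet> x = (if b = x then w n \<bullet> x else 0)" if "b \<in> B" for b
        using B(3)[OF step] B(2)[unfolded pairwise_def, rule_format, OF that step]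
        by (auto simp: orthogonal_def norm_eq_1)
      then have "u n \<bullet> x = (\<Sum>b\<in>B. if b = x then w n \<bullet> x else 0)"
        unfolding u_def inner_sum_left by (intro sum.cong refl) blast
      with step fin show ?case by simp
    qed
  qed
qed

text \<open>
  A sequence of covectors \<open>w n\<close> need not select a face of the convex hull of \<open>E\<close>, since the values
  on \<open>E\<close> may stay at bounded distance without being equal.  After passing to a subsequence let
  \<open>A\<close> be the points whose value exceeds the minimum by a bounded amount.  On the differences of
  points of \<open>A\<close> the covectors converge, and subtracting the orthogonal projection to their span
  changes \<open>w n\<close> by a convergent amount and makes it constant on \<open>A\<close>.  So \<open>A\<close> becomes
  exactly the minimizing set of \<open>w (r n) - u n\<close> for large \<open>n\<close>.  The vectors in \<open>G\<close> are thrown into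
  the same span in order to preserve prescribed zeros of the covectors.
\<close>

lemma weight_extraction:
  fixes w :: "nat \<Rightarrow> 'a::euclidean_space"
  assumes fin: "finite E" and ne: "E \<noteq> {}" and G: "\<And>n q. q \<in> G \<Longrightarrow> w n \<bullet> q = 0"
  obtains r A u C where "strict_mono r" "A \<subseteq> E" "A \<noteq> {}" "convergent u"
    "\<And>n q. q \<in> G \<Longrightarrow> u n \<bullet> q = 0"
    "\<And>n \<xi> \<xi>'. \<xi> \<in> A \<Longrightarrow> \<xi>' \<in> A \<Longrightarrow> (w (r n) - u n) \<bullet> (\<xi>' - \<xi>) = 0"
    "\<And>\<xi> \<xi>'. \<xi> \<in> A \<Longrightarrow> \<xi>' \<in> E - A \<Longrightarrow>
       filterlim (\<lambda>n. (w (r n) - u n) \<bullet> (\<xi>' - \<xi>)) at_top sequentially"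
    "\<And>n \<xi> \<xi>'. \<xi> \<in> A \<Longrightarrow> \<xi>' \<in> E \<Longrightarrow> w (r n) \<bullet> \<xi> \<le> w (r n) \<bullet> \<xi>' + C"
proof -
  define m where "m n = Min ((\<lambda>\<xi>. w n \<bullet> \<xi>) ` E)" for n
  have m_le: "m n \<le> w n \<bullet> \<xi>" if "\<xi> \<in> E" for n \<xi>
    unfolding m_def using fin that by simp
  have m_attained: "\<exists>\<xi>\<in>E. w n \<bullet> \<xi> = m n" for n
  proof -
    have "m n \<in> (\<lambda>\<xi>. w n \<bullet> \<xi>) ` E"
      unfolding m_def using fin ne by (intro Min_in) auto
    then show ?thesis by force
  qed
  \<comment> \<open>Exponentiating the excess over the minimum gives values in the compact interval from 0 to 1;
    a positive limit means a bounded excess.\<close>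
  define g where "g \<xi> n = exp (m n - w n \<bullet> \<xi>)" for \<xi> n
  have "\<bar>g \<xi> n\<bar> \<le> 1" if "\<xi> \<in> E" for \<xi> n
    using m_le[OF that] by (simp add: g_def)
  then obtain r where r: "strict_mono r" and conv: "\<And>\<xi>. \<xi> \<in> E \<Longrightarrow> convergent (\<lambda>n. g \<xi> (r n))"
    using convergent_common_subseq[OF fin, of g] by blast
  define l where "l \<xi> = lim (\<lambda>n. g \<xi> (r n))" for \<xi>
  have l: "(\<lambda>n. g \<xi> (r n)) \<longlonglongrightarrow> l \<xi>" if "\<xi> \<in> E" for \<xi>
    using conv[OF that] unfolding l_def by (simp add: convergent_LIMSEQ_iff)
  have l_nonneg: "0 \<le> l \<xi>" if "\<xi> \<in> E" for \<xi>
    by (rule LIMSEQ_le_const[OF l[OF that]]) (simp add: g_def)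
  define A where "A = {\<xi> \<in> E. l \<xi> > 0}"
  have A_sub: "A \<subseteq> E" by (auto simp: A_def)
  have A_ne: "A \<noteq> {}"
  proof
    assume "A = {}"
    then have "l \<xi> = 0" if "\<xi> \<in> E" for \<xi>
      using l_nonneg[OF that] that unfolding A_def by force
    then have "(\<lambda>n. \<Sum>\<xi>\<in>E. g \<xi> (r n)) \<longlonglongrightarrow> (\<Sum>\<xi>\<in>E. 0)"
      using l by (intro tendsto_sum) force
    moreover have "1 \<le> (\<Sum>\<xi>\<in>E. g \<xi> (r n))" for n
    proof -
      obtain \<xi> where \<xi>: "\<xi> \<in> E" "w (r n) \<bullet> \<xi> = m (r n)"
        using m_attained by blast
      have "g \<xi> (r n) \<le> (\<Sum>\<xi>\<in>E. g \<xi> (r n))"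
        using fin \<xi>(1) by (intro member_le_sum) (auto simp: g_def)
      with \<xi>(2) show ?thesis by (simp add: g_def)
    qed
    ultimately have "1 \<le> (\<Sum>\<xi>\<in>E. (0::real))"
      by (intro LIMSEQ_le_const) auto
    then show False by simp
  qed
  have excess: "w n \<bullet> \<xi> - m n = - ln (g \<xi> n)" for \<xi> n
    by (simp add: g_def)
  have excess_A: "convergent (\<lambda>n. w (r n) \<bullet> \<xi> - m (r n))" if "\<xi> \<in> A" for \<xi>
  proof -
    have "(\<lambda>n. - ln (g \<xi> (r n))) \<longlonglongrightarrow> - ln (l \<xi>)"
      using that l unfolding A_def by (intro tendsto_minus tendsto_ln) auto
    then show ?thesis
      unfolding excess by (rule convergentI)
  qed
  have excess_rest: "filterlim (\<lambda>n. w (r n) \<bullet> \<xi> - m (r n)) at_top sequentially" if "\<xi> \<in> E - A" for \<xi>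
  proof -
    have "l \<xi> = 0"
      using that l_nonneg[of \<xi>] unfolding A_def by force
    then have "(\<lambda>n. g \<xi> (r n)) \<longlonglongrightarrow> 0"
      using l[of \<xi>] that by simp
    then have "filterlim (\<lambda>n. g \<xi> (r n)) (at_right 0) sequentially"
      by (rule tendsto_imp_filterlim_at_right) (simp add: g_def)
    then have "filterlim (\<lambda>n. ln (g \<xi> (r n))) at_bot sequentially"
      by (rule filterlim_compose[OF ln_at_0])
    then show ?thesis
      unfolding excess by (simp add: filterlim_uminus_at_top)
  qed
  have diff: "w (r n) \<bullet> (\<xi>' - \<xi>) = (w (r n) \<bullet> \<xi>' - m (r n)) - (w (r n) \<bullet> \<xi> - m (r n))" for n \<xi> \<xi>'
    by (simp add: inner_diff_right)
  have "convergent (\<lambda>n. w (r n) \<bullet> q)" if "q \<in> G \<union> {\<xi>' - \<xi> | \<xi> \<xi>'. \<xi> \<in> A \<and> \<xi>' \<in> A}" for q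
  proof (cases "q \<in> G")
    case True
    then show ?thesis by (simp add: G convergent_const)
  next
    case False
    with that obtain \<xi> \<xi>' where "\<xi> \<in> A" "\<xi>' \<in> A" "q = \<xi>' - \<xi>" by blast
    then show ?thesis
      unfolding diff using excess_A by (simp only: diff) (intro convergent_diff excess_A)
  qed
  then obtain u where u: "convergent u"
      and uq: "\<And>n q. q \<in> G \<union> {\<xi>' - \<xi> | \<xi> \<xi>'. \<xi> \<in> A \<and> \<xi>' \<in> A} \<Longrightarrow> u n \<bullet> q = w (r n) \<bullet> q"
    using projection_part_convergent[of "G \<union> {\<xi>' - \<xi> | \<xi> \<xi>'. \<xi> \<in> A \<and> \<xi>' \<in> A}" "\<lambda>n. w (r n)"] by blast
  have "\<exists>B. \<forall>n. w (r n) \<bullet> \<xi> - m (r n) \<le> B" if "\<xi> \<in> A" for \<xi>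
  proof -
    have "Bseq (\<lambda>n. w (r n) \<bullet> \<xi> - m (r n))"
      using excess_A[OF that] by (rule convergent_imp_Bseq)
    then show ?thesis
      unfolding Bseq_def real_norm_def by (meson abs_le_D1)
  qed
  then obtain b where b: "\<And>\<xi> n. \<xi> \<in> A \<Longrightarrow> w (r n) \<bullet> \<xi> - m (r n) \<le> b \<xi>"
    by metis
  have "finite A"
    using A_sub fin by (rule finite_subset)
  show thesis
  proof (rule that[OF r A_sub A_ne u])
    show "u n \<bullet> q = 0" if "q \<in> G" for n q
      using uq[of q n] G[OF that] that by simp
    show "(w (r n) - u n) \<bullet> (\<xi>' - \<xi>) = 0" if "\<xi> \<in> A" "\<xi>' \<in> A" for n \<xi> \<xi>'
    proof -
      have "u n \<bullet> (\<xi>' - \<xi>) = w (r n) \<bullet> (\<xi>' - \<xi>)"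
        using that by (intro uq) blast
      then show ?thesis by (simp add: inner_diff_left)
    qed
    show "filterlim (\<lambda>n. (w (r n) - u n) \<bullet> (\<xi>' - \<xi>)) at_top sequentially"
      if \<xi>: "\<xi> \<in> A" and \<xi>': "\<xi>' \<in> E - A" for \<xi> \<xi>'
    proof -
      obtain c u0 where c: "(\<lambda>n. w (r n) \<bullet> \<xi> - m (r n)) \<longlonglongrightarrow> c" and u0: "u \<longlonglongrightarrow> u0"
        using excess_A[OF \<xi>] u unfolding convergent_def by blast
      have "(\<lambda>n. - (w (r n) \<bullet> \<xi> - m (r n)) - u n \<bullet> (\<xi>' - \<xi>)) \<longlonglongrightarrow> - c - u0 \<bullet> (\<xi>' - \<xi>)"
        by (intro tendsto_intros c u0)
      from filterlim_tendsto_add_at_top[OF this excess_rest[OF \<xi>']] show ?thesis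
        by (rule filterlim_mono[OF _ order_refl order_refl, THEN filterlim_cong[OF refl refl, THEN iffD1, rotated]])
           (simp add: inner_diff_left inner_diff_right algebra_simps)
    qed
    show "w (r n) \<bullet> \<xi> \<le> w (r n) \<bullet> \<xi>' + (\<Sum>\<xi>\<in>A. \<bar>b \<xi>\<bar>)" if "\<xi> \<in> A" "\<xi>' \<in> E" for n \<xi> \<xi>'
    proof -
      have "\<bar>b \<xi>\<bar> \<le> (\<Sum>\<xi>\<in>A. \<bar>b \<xi>\<bar>)"
        using \<open>finite A\<close> that(1) by (intro member_le_sum) auto
      with b[OF that(1), of n] m_le[OF that(2), of "r n"] show ?thesis by linarith
    qed
  qed
qed

section \<open>Rescaling a convergent sequence\<close>

text \<open>
  This takes the place of the leading terms of an analytic curve \<open>z\<^sub>i = a\<^sub>i t^p\<^sub>i + \<dots>\<close> that a curve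
  selection lemma would give.  The weights start as \<open>- ln (cmod (z n $ i))\<close> for the coordinates
  tending to \<open>0\<close>, and as \<open>0\<close> for the others; \<open>weight_extraction\<close>, applied to the exponents of \<open>f\<close>, splits
  off a bounded part, which moves into the coefficients \<open>a n\<close>.  The set \<open>S\<close> collects the monomials
  of \<open>f\<close> of lowest order along the sequence.  Coordinates of \<open>z n\<close> that vanish receive a weight so
  large that no monomial containing them can be of lowest order; such a coordinate may
  vanish in \<open>a0\<close> as well, but then it occurs in no monomial of \<open>S\<close>.
\<close>

lemma toric_rescaling:
  fixes f :: "'n::finite mixed_poly" and z :: "nat \<Rightarrow> complex ^ 'n" and z0 :: "complex ^ 'n"
  defines "J \<equiv> {i. z0 $ i \<noteq> 0}"
  assumes lim: "z \<longlonglongrightarrow> z0" and nz: "\<And>n. mixed_eval f (z n) \<noteq> 0"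
  obtains r p a a0 S k0 where
    "strict_mono r" "\<And>n. z (r n) = torus_scale (p n) (a n)" "a \<longlonglongrightarrow> a0"
    "\<And>n i. i \<in> J \<Longrightarrow> p n $ i = 0" "\<And>i. i \<in> J \<Longrightarrow> a0 $ i = z0 $ i"
    "\<And>i. i \<notin> J \<Longrightarrow> filterlim (\<lambda>n. p n $ i) at_top sequentially"
    "S \<subseteq> Poly_Mapping.keys f" "k0 \<in> S"
    "\<And>n k. k \<in> S \<Longrightarrow> p n \<bullet> (exponent_sum k - exponent_sum k0) = 0"
    "\<And>k. k \<in> Poly_Mapping.keys f - S \<Longrightarrow>
       filterlim (\<lambda>n. p n \<bullet> (exponent_sum k - exponent_sum k0)) at_top sequentially"
    "\<And>i k. a0 $ i = 0 \<Longrightarrow> k \<in> S \<Longrightarrow> exponent_sum k $ i = 0"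
proof -
  \<comment> \<open>\<open>T n\<close> bounds the weighted degree, with respect to the finite weights, of every monomial of
    \<open>f\<close>; the weight of a vanishing coordinate exceeds it by \<open>n\<close>.\<close>
  define w' :: "nat \<Rightarrow> real ^ 'n" where
    "w' n = (\<chi> i. if i \<in> J \<or> z n $ i = 0 then 0 else - ln (cmod (z n $ i)))" for n
  define T where "T n = (\<Sum>k\<in>Poly_Mapping.keys f. \<bar>w' n \<bullet> exponent_sum k\<bar>)" for n
  define w :: "nat \<Rightarrow> real ^ 'n" where
    "w n = (\<chi> i. if i \<in> J then 0 else if z n $ i = 0 then real n + T n
                 else - ln (cmod (z n $ i)))" for n
  define b :: "nat \<Rightarrow> complex ^ 'n" where "b n = (\<chi> i. of_real (exp (w n $ i)) * z n $ i)" for n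
  have T_nonneg: "0 \<le> T n" for n
    by (simp add: T_def sum_nonneg)
  have T_ge: "w' n \<bullet> exponent_sum k \<le> T n" if "k \<in> Poly_Mapping.keys f" for n k
  proof -
    have "\<bar>w' n \<bullet> exponent_sum k\<bar> \<le> T n"
      unfolding T_def using that by (intro member_le_sum) auto
    then show ?thesis by linarith
  qed
  have zi: "(\<lambda>n. z n $ i) \<longlonglongrightarrow> z0 $ i" for i
    using lim by (rule tendsto_vec_nth)
  have w_top: "filterlim (\<lambda>n. w n $ i) at_top sequentially" if i: "i \<notin> J" for i
    unfolding filterlim_at_top
  proof
    fix B :: real
    have "(\<lambda>n. cmod (z n $ i)) \<longlonglongrightarrow> 0"
      using tendsto_norm[OF zi[of i]] i by (simp add: J_def)
    then have "eventually (\<lambda>n. cmod (z n $ i) < exp (- B)) sequentially"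
      by (rule order_tendstoD) simp
    moreover have "eventually (\<lambda>n. B \<le> real n) sequentially"
      using filterlim_real_sequentially unfolding filterlim_at_top by blast
    ultimately show "eventually (\<lambda>n. B \<le> w n $ i) sequentially"
    proof eventually_elim
      case (elim n)
      show ?case
      proof (cases "z n $ i = 0")
        case True
        then show ?thesis
          using i elim T_nonneg[of n] by (simp add: w_def)
      next
        case False
        then have "ln (cmod (z n $ i)) < - B"
          using elim(1) by (metis ln_exp ln_less_cancel_iff exp_gt_zero zero_less_norm_iff)
        with False show ?thesis
          using i by (simp add: w_def)
      qed
    qed
  qed
  \<comment> \<open>\<open>b n\<close> is \<open>z n\<close> with its small coordinates normalized to absolute value \<open>1\<close> or \<open>0\<close>, hence bounded.\<close>
  have b_J: "b n $ i = z n $ i" if "i \<in> J" for n i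
    using that by (simp add: b_def w_def)
  have b_unit: "cmod (b n $ i) = 1" if "i \<notin> J" "z n $ i \<noteq> 0" for n i
    using that by (simp add: b_def w_def norm_mult norm_inverse exp_minus)
  have b_zero: "b n $ i = 0" if "z n $ i = 0" for n i
    using that by (simp add: b_def)
  have "bounded (range b)"
  proof -
    obtain K where K: "\<And>n. norm (z n) \<le> K"
      using convergent_imp_Bseq[OF convergentI[OF lim]] unfolding Bseq_def by blast
    have "norm (b n $ i) \<le> K + 1" for n i
    proof (cases "i \<in> J \<or> z n $ i = 0")
      case True
      then have "norm (b n $ i) \<le> norm (z n $ i)"
        using b_J b_zero by auto
      also have "\<dots> \<le> norm (z n)"
        by (rule Finite_Cartesian_Product.norm_nth_le)
      finally show ?thesis
        using K[of n] by simp
    next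
      case False
      then show ?thesis
        using b_unit[of i n] order_trans[OF norm_ge_zero K[of n]] by simp
    qed
    then have "norm (b n) \<le> (\<Sum>i\<in>(UNIV :: 'n set). K + 1)" for n
      unfolding norm_vec_def by (intro order_trans[OF L2_set_le_sum] sum_mono) auto
    then show ?thesis
      unfolding bounded_iff by blast
  qed
  then obtain b0 r1 where r1: "strict_mono r1" and b0: "(b \<circ> r1) \<longlonglongrightarrow> b0"
    using bounded_imp_convergent_subsequence by blast
  let ?E = "exponent_sum ` Poly_Mapping.keys f"
  let ?G = "(\<lambda>j. axis j 1) ` J :: (real ^ 'n) set"
  have E: "finite ?E" "?E \<noteq> {}"
    using nz[of 0] by (auto simp: mixed_eval_def)
  have G: "w (r1 n) \<bullet> q = 0" if "q \<in> ?G" for n q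
    using that by (auto simp: inner_axis w_def)
  obtain r2 A u C where r2: "strict_mono r2" and A: "A \<subseteq> ?E" "A \<noteq> {}" and "convergent u"
    and uG: "\<And>n q. q \<in> ?G \<Longrightarrow> u n \<bullet> q = 0"
    and pA: "\<And>n \<xi> \<xi>'. \<xi> \<in> A \<Longrightarrow> \<xi>' \<in> A \<Longrightarrow> (w (r1 (r2 n)) - u n) \<bullet> (\<xi>' - \<xi>) = 0"
    and pE: "\<And>\<xi> \<xi>'. \<xi> \<in> A \<Longrightarrow> \<xi>' \<in> ?E - A \<Longrightarrow>
       filterlim (\<lambda>n. (w (r1 (r2 n)) - u n) \<bullet> (\<xi>' - \<xi>)) at_top sequentially"
    and C: "\<And>n \<xi> \<xi>'. \<xi> \<in> A \<Longrightarrow> \<xi>' \<in> ?E \<Longrightarrow> w (r1 (r2 n)) \<bullet> \<xi> \<le> w (r1 (r2 n)) \<bullet> \<xi>' + C"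
    apply (rule weight_extraction[of ?E ?G "\<lambda>n. w (r1 n)", OF E G])
     apply assumption
    subgoal premises prems by (rule prems(1)[OF prems(2-)])
    done
  then obtain u0 where u0: "u \<longlonglongrightarrow> u0"
    unfolding convergent_def by blast
  define r where "r n = r1 (r2 n)" for n
  have r: "strict_mono r"
    using strict_mono_o[OF r1 r2] by (simp add: r_def[abs_def] o_def)
  have br: "(\<lambda>n. b (r n)) \<longlonglongrightarrow> b0"
    using LIMSEQ_subseq_LIMSEQ[OF b0 r2] by (simp add: o_def r_def)
  have uJ: "u n $ i = 0" if "i \<in> J" for n i
    using uG[of "axis i 1" n] that by (simp add: inner_axis)
  define p where "p n = w (r n) - u n" for n
  define a :: "nat \<Rightarrow> complex ^ 'n" where "a n = (\<chi> i. of_real (exp (- u n $ i)) * b (r n) $ i)" for n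
  define a0 :: "complex ^ 'n" where "a0 = (\<chi> i. of_real (exp (- u0 $ i)) * b0 $ i)"
  define S where "S = {k \<in> Poly_Mapping.keys f. exponent_sum k \<in> A}"
  obtain k0 where k0: "k0 \<in> S"
    using A unfolding S_def by blast
  have u0J: "u0 $ i = 0" if "i \<in> J" for i
    using tendsto_vec_nth[OF u0, of i] uJ[OF that] by (simp add: LIMSEQ_const_iff)
  have b0J: "b0 $ i = z0 $ i" if "i \<in> J" for i
  proof -
    have "(\<lambda>n. z (r n) $ i) \<longlonglongrightarrow> b0 $ i"
      using tendsto_vec_nth[OF br, of i] b_J[OF that] by simp
    moreover have "(\<lambda>n. z (r n) $ i) \<longlonglongrightarrow> z0 $ i"
      using LIMSEQ_subseq_LIMSEQ[OF zi r] by (simp add: o_def)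
    ultimately show ?thesis
      by (rule LIMSEQ_unique)
  qed
  have w_top_r: "filterlim (\<lambda>n. w (r n) $ i) at_top sequentially" if "i \<notin> J" for i
    by (rule filterlim_compose[OF w_top[OF that] filterlim_subseq[OF r]])
  show thesis
  proof (rule that[OF r, of p a a0 S k0])
    show "z (r n) = torus_scale (p n) (a n)" for n
      by (simp add: vec_eq_iff torus_scale_def p_def a_def b_def exp_minus exp_diff field_simps)
    show "a \<longlonglongrightarrow> a0"
    proof (rule vec_tendstoI)
      fix i
      show "(\<lambda>n. a n $ i) \<longlonglongrightarrow> a0 $ i"
        unfolding a_def a0_def vec_lambda_beta
        by (intro tendsto_intros tendsto_vec_nth u0 br)
    qed
    show "p n $ i = 0" if "i \<in> J" for n i
      using that uJ by (simp add: p_def w_def)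
    show "a0 $ i = z0 $ i" if "i \<in> J" for i
      using that u0J b0J by (simp add: a0_def)
    show "filterlim (\<lambda>n. p n $ i) at_top sequentially" if "i \<notin> J" for i
    proof -
      have "filterlim (\<lambda>n. - u n $ i + w (r n) $ i) at_top sequentially"
        by (rule filterlim_tendsto_add_at_top[OF tendsto_minus[OF tendsto_vec_nth[OF u0]] w_top_r[OF that]])
      then show ?thesis by (simp add: p_def)
    qed
    show "S \<subseteq> Poly_Mapping.keys f" "k0 \<in> S"
      using k0 by (auto simp: S_def)
    show "p n \<bullet> (exponent_sum k - exponent_sum k0) = 0" if "k \<in> S" for n k
      using pA that k0 by (simp add: p_def r_def S_def)
    show "filterlim (\<lambda>n. p n \<bullet> (exponent_sum k - exponent_sum k0)) at_top sequentially"
      if "k \<in> Poly_Mapping.keys f - S" for k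
      using pE[of "exponent_sum k0" "exponent_sum k"] that k0 by (simp add: p_def r_def S_def)
    \<comment> \<open>Otherwise \<open>z ?y $ i = 0\<close> for some large index \<open>?y\<close>, and the monomial \<open>k\<close> has a much larger weighted
      degree than a monomial \<open>k1\<close> that does not vanish at \<open>z ?y\<close>.\<close>
    show "exponent_sum k $ i = 0" if ai: "a0 $ i = 0" and k: "k \<in> S" for i k
    proof (rule ccontr)
      assume "exponent_sum k $ i \<noteq> 0"
      then have ki: "1 \<le> exponent_sum k $ i"
        unfolding exponent_sum_def vec_lambda_beta
        by (cases "fst k $ i + snd k $ i") (simp_all del: of_nat_add)
      have b0i: "b0 $ i = 0"
        using ai by (simp add: a0_def)
      then have i: "i \<notin> J"
        using b0J[of i] by (auto simp: J_def)
      have "(\<lambda>n. cmod (b (r n) $ i)) \<longlonglongrightarrow> 0"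
        using tendsto_norm[OF tendsto_vec_nth[OF br, of i]] b0i by simp
      then have "eventually (\<lambda>n. cmod (b (r n) $ i) < 1) sequentially"
        by (rule order_tendstoD) simp
      moreover have "eventually (\<lambda>n. \<forall>j. 0 \<le> w (r n) $ j) sequentially"
      proof (rule eventually_all_finite)
        fix j
        show "eventually (\<lambda>n. 0 \<le> w (r n) $ j) sequentially"
        proof (cases "j \<in> J")
          case True
          then show ?thesis by (simp add: w_def)
        next
          case False
          from w_top_r[OF this] show ?thesis
            unfolding filterlim_at_top by blast
        qed
      qed
      moreover have "eventually (\<lambda>n. C < real n) sequentially"
        using filterlim_real_sequentially unfolding filterlim_at_top_dense by blast
      ultimately have "eventually (\<lambda>n. cmod (b (r n) $ i) < 1 \<and> (\<forall>j. 0 \<le> w (r n) $ j) \<and> C < real n) sequentially"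
        by eventually_elim blast
      then obtain N where N: "cmod (b (r N) $ i) < 1" "\<And>j. 0 \<le> w (r N) $ j" "C < real N"
        using eventually_happens'[OF sequentially_bot] by blast
      let ?y = "r N"
      have yi: "z ?y $ i = 0"
        using b_unit[OF i, of ?y] N(1) by auto
      have "N \<le> ?y"
        using r by (rule seq_suble)
      then have yC: "C < real ?y"
        using N(3) by linarith
      obtain k1 where k1: "k1 \<in> Poly_Mapping.keys f" "mixed_monom k1 (z ?y) \<noteq> 0"
      proof -
        have "\<exists>k1\<in>Poly_Mapping.keys f. Poly_Mapping.lookup f k1 * mixed_monom k1 (z ?y) \<noteq> 0"
          using nz[of ?y] unfolding mixed_eval_def by (meson sum.neutral)
        then show thesis
          using that by auto
      qed
      have "w ?y \<bullet> exponent_sum k1 = w' ?y \<bullet> exponent_sum k1"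
        unfolding inner_vec_def
      proof (intro sum.cong refl)
        fix j
        show "w ?y $ j \<bullet> exponent_sum k1 $ j = w' ?y $ j \<bullet> exponent_sum k1 $ j"
        proof (cases "z ?y $ j = 0")
          case True
          then have "fst k1 $ j = 0 \<and> snd k1 $ j = 0"
            using k1(2) by (auto simp: mixed_monom_def prod_zero_iff)
          then show ?thesis by (simp add: exponent_sum_def)
        next
          case False
          then show ?thesis by (simp add: w_def w'_def)
        qed
      qed
      then have "w ?y \<bullet> exponent_sum k1 \<le> T ?y"
        using T_ge[OF k1(1)] by simp
      moreover have "w ?y $ i = real ?y + T ?y"
        using i yi by (simp add: w_def)
      moreover have "w ?y $ i \<le> w ?y \<bullet> exponent_sum k"
      proof -
        have "w ?y $ i * 1 \<le> w ?y $ i * exponent_sum k $ i"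
          using ki N(2) by (intro mult_left_mono)
        also have "\<dots> \<le> (\<Sum>j\<in>UNIV. w ?y $ j * exponent_sum k $ j)"
          using N(2) by (intro member_le_sum) (auto simp: exponent_sum_def)
        finally show ?thesis by (simp add: inner_vec_def)
      qed
      moreover have "w ?y \<bullet> exponent_sum k \<le> w ?y \<bullet> exponent_sum k1 + C"
        using C[of "exponent_sum k" "exponent_sum k1" N] k k1(1) by (simp add: S_def r_def)
      ultimately show False
        using yC by linarith
    qed
  qed
qed

section \<open>Limits of points with multipliers\<close>

text \<open>
  The monomials of the face function do not contain the coordinates in which \<open>a\<close> and \<open>b\<close> differ, so
  the function is invariant under translation by \<open>b - a\<close>.
\<close>

lemma face_fun_derivative_insensitive:
  fixes a b :: "complex ^ 'n::finite"
  assumes "\<And>i k. b $ i \<noteq> a $ i \<Longrightarrow> k \<in> Poly_Mapping.keys f \<Longrightarrow> exponent_sum k \<in> \<Delta> \<Longrightarrow> exponent_sum k $ i = 0"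
  shows "frechet_derivative (face_fun f \<Delta>) (at b) = frechet_derivative (face_fun f \<Delta>) (at a)"
proof -
  let ?F = "face_fun f \<Delta>"
  have mono: "mixed_monom k (x + (b - a)) = mixed_monom k x"
    if k: "k \<in> Poly_Mapping.keys f" "exponent_sum k \<in> \<Delta>" for k x
    unfolding mixed_monom_def
  proof (intro prod.cong refl)
    fix i
    show "((x + (b - a)) $ i) ^ (fst k $ i) * cnj ((x + (b - a)) $ i) ^ (snd k $ i) =
        (x $ i) ^ (fst k $ i) * cnj (x $ i) ^ (snd k $ i)"
    proof (cases "b $ i = a $ i")
      case False
      then have "exponent_sum k $ i = 0"
        using assms k by blast
      then have "fst k $ i = 0" "snd k $ i = 0"
        by (simp_all add: exponent_sum_def)
      then show ?thesis by simp
    qed simp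
  qed
  have inv: "?F (x + (b - a)) = ?F x" for x
    unfolding face_fun_def by (intro sum.cong refl) (simp add: mono)
  have "((\<lambda>x. x + (b - a)) has_derivative (\<lambda>v. v)) (at a)"
    by (auto intro!: derivative_eq_intros)
  moreover have "(?F has_derivative frechet_derivative ?F (at b)) (at (a + (b - a)))"
    using differentiable_face_fun[of f \<Delta> b] by (simp add: frechet_derivative_works)
  ultimately have "((\<lambda>x. ?F (x + (b - a))) has_derivative (\<lambda>v. frechet_derivative ?F (at b) v)) (at a)"
    by (rule has_derivative_compose)
  then have "(?F has_derivative frechet_derivative ?F (at b)) (at a)"
    by (simp add: inv)
  then show ?thesis
    by (rule frechet_derivative_at)
qed

lemma sum_support_norm_power2:
  fixes z :: "complex ^ 'n::finite"
  shows "(\<Sum>j\<in>{i. z $ i \<noteq> 0}. (cmod (z $ j))\<^sup>2) = (norm z)\<^sup>2"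
proof -
  have "(norm z)\<^sup>2 = (\<Sum>j\<in>UNIV. (cmod (z $ j))\<^sup>2)"
    by (simp add: norm_vec_def L2_set_def sum_nonneg)
  also have "\<dots> = (\<Sum>j\<in>{i. z $ i \<noteq> 0}. (cmod (z $ j))\<^sup>2)"
    by (rule sum.mono_neutral_right) auto
  finally show ?thesis ..
qed

lemma subspace_coord_subspace: "subspace (coord_subspace I :: (complex ^ 'n::finite) set)"
  by (auto simp: subspace_def coord_subspace_def)

text \<open>
  Write \<open>z (r n) = torus_scale (p n) (a n)\<close> and test the multiplier equation on the rescaled vectors
  \<open>torus_scale (p n) v\<close>.  The rescaled differentials \<open>M n\<close> tend to the differential \<open>L\<close> at \<open>a0\<close> of the
  face function of an essential face, and the rescaled multipliers \<open>\<mu> n\<close> satisfy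
  \<open>z (r n) \<bullet> torus_scale (p n) v = \<mu> n \<bullet> M n v\<close>.  For \<open>v\<close> in the complementary directions \<open>- J\<close> the left side
  tends to \<open>0\<close>; by tameness \<open>L\<close> is onto already on these directions, so \<open>\<mu>\<close> tends to \<open>0\<close>.  But for
  \<open>v = z0\<close>, which the rescaling fixes, the left side tends to the squared norm of \<open>z0\<close>, which
  is positive.
\<close>

lemma tame_face_excludes_multipliers:
  fixes f :: "'n::finite mixed_poly" and z :: "nat \<Rightarrow> complex ^ 'n" and z0 :: "complex ^ 'n"
  defines "J \<equiv> {i. z0 $ i \<noteq> 0}"
  assumes lim: "z \<longlonglongrightarrow> z0" and J: "J \<in> vanishing_sets f"
    and nz: "\<And>n. mixed_eval f (z n) \<noteq> 0"
    and lam: "\<And>n v. z n \<bullet> v = lam n \<bullet> frechet_derivative (mixed_eval f) (at (z n)) v"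
    and tame: "\<And>\<Delta>. essential_face f \<Delta> \<Longrightarrow> face_index f \<Delta> = J \<Longrightarrow> tame_up_to f \<Delta> (norm z0)"
  shows False
proof -
  obtain r p a a0 S k0 where
      r: "strict_mono r" and zr: "\<And>n. z (r n) = torus_scale (p n) (a n)" and a: "a \<longlonglongrightarrow> a0"
    and pJ: "\<And>n i. i \<in> J \<Longrightarrow> p n $ i = 0" and aJ: "\<And>i. i \<in> J \<Longrightarrow> a0 $ i = z0 $ i"
    and p_top: "\<And>i. i \<notin> J \<Longrightarrow> filterlim (\<lambda>n. p n $ i) at_top sequentially"
    and S: "S \<subseteq> Poly_Mapping.keys f" and k0: "k0 \<in> S"
    and pS: "\<And>n k. k \<in> S \<Longrightarrow> p n \<bullet> (exponent_sum k - exponent_sum k0) = 0"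
    and p_rest: "\<And>k. k \<in> Poly_Mapping.keys f - S \<Longrightarrow>
       filterlim (\<lambda>n. p n \<bullet> (exponent_sum k - exponent_sum k0)) at_top sequentially"
    and a0: "\<And>i k. a0 $ i = 0 \<Longrightarrow> k \<in> S \<Longrightarrow> exponent_sum k $ i = 0"
    apply (rule toric_rescaling[of z z0 f, OF lim nz, folded J_def])
    subgoal premises prems by (rule prems(1)[OF prems(2-)])
    done
  have "eventually (\<lambda>n. \<forall>i\<in>- J. 0 < p n $ i) sequentially"
    using p_top unfolding filterlim_at_top_dense by (intro eventually_ball_finite) auto
  moreover have "eventually (\<lambda>n. \<forall>k\<in>Poly_Mapping.keys f - S.
      0 < p n \<bullet> (exponent_sum k - exponent_sum k0)) sequentially"
    using p_rest unfolding filterlim_at_top_dense by (intro eventually_ball_finite) auto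
  ultimately have "eventually (\<lambda>n. (\<forall>i\<in>- J. 0 < p n $ i) \<and> (\<forall>k\<in>Poly_Mapping.keys f - S.
      0 < p n \<bullet> (exponent_sum k - exponent_sum k0))) sequentially"
    by eventually_elim blast
  \<comment> \<open>A single weight far out in the sequence cuts out the face: on the exponents of \<open>f\<close> it is minimal
    exactly on those of \<open>S\<close>, and it vanishes exactly on \<open>J\<close>.\<close>
  then obtain N where N1: "\<And>i. i \<notin> J \<Longrightarrow> 0 < p N $ i"
      and N2: "\<And>k. k \<in> Poly_Mapping.keys f - S \<Longrightarrow> 0 < p N \<bullet> (exponent_sum k - exponent_sum k0)"
    using eventually_happens'[OF sequentially_bot] by blast
  let ?P = "p N"
  let ?\<Delta> = "weight_face f ?P"
  have P_nonneg: "0 \<le> ?P $ i" for i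
    using N1[of i] pJ[of i N] by (cases "i \<in> J") auto
  have k0f: "k0 \<in> Poly_Mapping.keys f"
    using S k0 by blast
  have P_min: "?P \<bullet> exponent_sum k0 \<le> ?P \<bullet> exponent_sum k" if "k \<in> Poly_Mapping.keys f" for k
  proof (cases "k \<in> S")
    case True
    from pS[OF True, of N] show ?thesis
      by (simp add: inner_diff_right)
  next
    case False
    with N2[of k] that show ?thesis
      by (simp add: inner_diff_right)
  qed
  have zeros: "weight_zeros ?P = J"
    using N1 pJ[of _ N] unfolding weight_zeros_def by force
  have ess: "essential_face f ?\<Delta>" and idx: "face_index f ?\<Delta> = J"
    using essential_weight_face[OF P_nonneg k0f P_min] J by (simp_all add: zeros)
  have monoms: "{k \<in> Poly_Mapping.keys f. exponent_sum k \<in> ?\<Delta>} = S"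
  proof -
    have "exponent_sum k \<in> ?\<Delta> \<longleftrightarrow> k \<in> S" if k: "k \<in> Poly_Mapping.keys f" for k
    proof -
      have "exponent_sum k \<in> ?\<Delta> \<longleftrightarrow> ?P \<bullet> exponent_sum k = ?P \<bullet> exponent_sum k0"
        using weight_face_eq(1)[OF P_nonneg k0f P_min] newton_polyhedron_exponent[OF k] by simp
      also have "\<dots> \<longleftrightarrow> k \<in> S"
        using N2[of k] pS[of k N] k by (cases "k \<in> S") (auto simp: inner_diff_right)
      finally show ?thesis .
    qed
    with S show ?thesis by blast
  qed
  define L where "L = frechet_derivative (face_fun f ?\<Delta>) (at a0)"
  have surj: "\<exists>v\<in>coord_subspace (- J). L v = c" for c
  proof -
    \<comment> \<open>The point \<open>a0\<close> may lie outside the torus, but only in coordinates that do not occur in the face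
      function; replacing them by \<open>1\<close> does not change the differential.\<close>
    define a1 :: "complex ^ 'n" where "a1 = (\<chi> i. if a0 $ i = 0 then 1 else a0 $ i)"
    have a1: "a1 \<in> coord_torus UNIV"
      by (simp add: a1_def coord_torus_def coord_subspace_def)
    have a1J: "a1 $ j = z0 $ j" if "j \<in> J" for j
      using aJ[OF that] that by (simp add: a1_def J_def)
    have "rho_face f ?\<Delta> a1 = (\<Sum>j\<in>J. (cmod (z0 $ j))\<^sup>2)"
      unfolding rho_face_def idx by (intro sum.cong refl) (simp add: a1J)
    also have "\<dots> = (norm z0)\<^sup>2"
      unfolding J_def by (rule sum_support_norm_power2)
    finally have "\<not> critical_along (coord_subspace (- J)) (face_fun f ?\<Delta>) a1"
      using tame[OF ess idx] a1 unfolding tame_up_to_def idx by simp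
    then obtain v where v: "v \<in> coord_subspace (- J)" "frechet_derivative (face_fun f ?\<Delta>) (at a1) v = c"
      by (rule noncritical_along_surj[OF _ differentiable_face_fun subspace_coord_subspace])
    have "frechet_derivative (face_fun f ?\<Delta>) (at a1) = L"
      unfolding L_def
    proof (rule face_fun_derivative_insensitive)
      fix i k assume "a1 $ i \<noteq> a0 $ i" "k \<in> Poly_Mapping.keys f" "exponent_sum k \<in> ?\<Delta>"
      moreover from this have "k \<in> S" using monoms by blast
      ultimately show "exponent_sum k $ i = 0"
        using a0 by (auto simp: a1_def split: if_splits)
    qed
    with v show ?thesis by blast
  qed
  define M where "M n v = (\<Sum>k\<in>Poly_Mapping.keys f.
      of_real (exp (- (p n \<bullet> (exponent_sum k - exponent_sum k0)))) *
      (Poly_Mapping.lookup f k * frechet_derivative (mixed_monom k) (at (a n)) v))" for n v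
  define \<mu> where "\<mu> n = exp (- (p n \<bullet> exponent_sum k0)) *\<^sub>R lam (r n)" for n
  have M_lim: "(\<lambda>n. M n v) \<longlonglongrightarrow> L v" for v
  proof -
    have "(\<lambda>n. complex_of_real (exp (- (p n \<bullet> (exponent_sum k - exponent_sum k0)))))
        \<longlonglongrightarrow> of_real (if k \<in> S then 1 else 0)" if "k \<in> Poly_Mapping.keys f" for k
    proof (cases "k \<in> S")
      case True
      then show ?thesis by (simp add: pS)
    next
      case False
      then have "filterlim (\<lambda>n. - (p n \<bullet> (exponent_sum k - exponent_sum k0))) at_bot sequentially"
        using p_rest[of k] that by (simp add: filterlim_uminus_at_top)
      then have "(\<lambda>n. exp (- (p n \<bullet> (exponent_sum k - exponent_sum k0)))) \<longlonglongrightarrow> 0"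
        by (rule filterlim_compose[OF exp_at_bot])
      then show ?thesis
        using False tendsto_of_real by fastforce
    qed
    then have "(\<lambda>n. M n v) \<longlonglongrightarrow> (\<Sum>k\<in>Poly_Mapping.keys f. of_real (if k \<in> S then 1 else 0) *
        (Poly_Mapping.lookup f k * frechet_derivative (mixed_monom k) (at a0) v))"
      unfolding M_def
      by (intro tendsto_sum tendsto_mult tendsto_const tendsto_mixed_monom_derivative a)
    also have "(\<Sum>k\<in>Poly_Mapping.keys f. of_real (if k \<in> S then 1 else 0) *
        (Poly_Mapping.lookup f k * frechet_derivative (mixed_monom k) (at a0) v)) =
        (\<Sum>k\<in>S. Poly_Mapping.lookup f k * frechet_derivative (mixed_monom k) (at a0) v)"
      using S by (intro sum.mono_neutral_cong_right) auto
    also have "\<dots> = L v"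
      unfolding L_def face_fun_derivative monoms ..
    finally show ?thesis .
  qed
  have rel: "z (r n) \<bullet> torus_scale (p n) v = \<mu> n \<bullet> M n v" for n v
  proof -
    have "frechet_derivative (mixed_eval f) (at (z (r n))) (torus_scale (p n) v)
        = (\<Sum>k\<in>Poly_Mapping.keys f. Poly_Mapping.lookup f k *
            (of_real (exp (- (p n \<bullet> exponent_sum k))) * frechet_derivative (mixed_monom k) (at (a n)) v))"
      by (simp add: mixed_eval_derivative zr mixed_monom_derivative_torus_scale)
    also have "\<dots> = exp (- (p n \<bullet> exponent_sum k0)) *\<^sub>R M n v"
      unfolding M_def scaleR_sum_right
      by (intro sum.cong refl) (simp add: inner_diff_right scaleR_conv_of_real exp_diff exp_minus field_simps)
    finally show ?thesis
      using lam[of "r n" "torus_scale (p n) v"] by (simp add: \<mu>_def)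
  qed
  have zr_lim: "(\<lambda>n. z (r n)) \<longlonglongrightarrow> z0"
    using LIMSEQ_subseq_LIMSEQ[OF lim r] by (simp add: o_def)
  have small: "(\<lambda>n. \<mu> n \<bullet> M n v) \<longlonglongrightarrow> 0" if v: "v \<in> coord_subspace (- J)" for v
  proof -
    have "(\<lambda>n. torus_scale (p n) v) \<longlonglongrightarrow> 0"
    proof (rule vec_tendstoI)
      fix i
      show "(\<lambda>n. torus_scale (p n) v $ i) \<longlonglongrightarrow> 0 $ i"
      proof (cases "i \<in> J")
        case True
        with v show ?thesis by (simp add: torus_scale_def coord_subspace_def)
      next
        case False
        then have "filterlim (\<lambda>n. - p n $ i) at_bot sequentially"
          using p_top[of i] by (simp add: filterlim_uminus_at_top)
        then have "(\<lambda>n. exp (- p n $ i)) \<longlonglongrightarrow> 0"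
          by (rule filterlim_compose[OF exp_at_bot])
        then have "(\<lambda>n. complex_of_real (exp (- p n $ i)) * v $ i) \<longlonglongrightarrow> of_real 0 * v $ i"
          by (intro tendsto_intros)
        then show ?thesis by (simp add: torus_scale_def)
      qed
    qed
    then have "(\<lambda>n. z (r n) \<bullet> torus_scale (p n) v) \<longlonglongrightarrow> z0 \<bullet> 0"
      by (intro tendsto_inner zr_lim)
    then show ?thesis by (simp add: rel)
  qed
  obtain v1 v2 where v: "v1 \<in> coord_subspace (- J)" "L v1 = 1" "v2 \<in> coord_subspace (- J)" "L v2 = \<i>"
    using surj by metis
  have "\<mu> \<longlonglongrightarrow> Complex 0 0"
    using M_lim[of v1] M_lim[of v2] v small by (intro multiplier_tendsto[of "\<lambda>n. M n v1" "\<lambda>n. M n v2"]) auto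
  then have "(\<lambda>n. \<mu> n \<bullet> M n z0) \<longlonglongrightarrow> Complex 0 0 \<bullet> L z0"
    by (intro tendsto_inner M_lim)
  moreover have "torus_scale (p n) z0 = z0" for n
    using pJ by (auto simp: torus_scale_def vec_eq_iff J_def)
  then have "\<mu> n \<bullet> M n z0 = z (r n) \<bullet> z0" for n
    using rel[of n z0] by simp
  ultimately have "(\<lambda>n. z (r n) \<bullet> z0) \<longlonglongrightarrow> 0"
    by (simp add: zero_complex.code[symmetric])
  moreover have "(\<lambda>n. z (r n) \<bullet> z0) \<longlonglongrightarrow> z0 \<bullet> z0"
    by (intro tendsto_inner tendsto_const zr_lim)
  ultimately have "z0 = 0"
    using LIMSEQ_unique by fastforce
  then have "J = {}"
    by (simp add: J_def)
  with J show False
    by (simp add: vanishing_sets_def)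
qed

text \<open>
  Transversality at the limit is an open condition: surjectivity of the limit differential makes the
  multipliers converge, the multiplier equation passes to the limit and says that \<open>z0\<close> is
  orthogonal to the tangent space of the fiber.  Being orthogonal to that of the sphere as well, it
  is orthogonal to the whole space.
\<close>

lemma transverse_limit_excludes_multipliers:
  fixes f :: "'n::finite mixed_poly" and z :: "nat \<Rightarrow> complex ^ 'n"
  assumes lim: "z \<longlonglongrightarrow> z0" and "z0 \<noteq> 0" and I: "subspace I"
    and nc: "\<not> critical_along I (mixed_eval f) z0"
    and span: "{u + v | u v. u \<in> fiber_tangent I (mixed_eval f) z0 \<and> v \<in> sphere_tangent z0} = UNIV"
    and lam: "\<And>n v. z n \<bullet> v = lam n \<bullet> frechet_derivative (mixed_eval f) (at (z n)) v"
  shows False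
proof -
  define D where "D n = frechet_derivative (mixed_eval f) (at (z n))" for n
  let ?D0 = "frechet_derivative (mixed_eval f) (at z0)"
  have D_lim: "(\<lambda>n. D n v) \<longlonglongrightarrow> ?D0 v" for v
    unfolding D_def mixed_eval_derivative
    by (intro tendsto_sum tendsto_mult tendsto_const tendsto_mixed_monom_derivative lim)
  obtain v1 where v1: "?D0 v1 = 1"
    by (rule noncritical_along_surj[OF nc differentiable_mixed_eval I])
  obtain v2 where v2: "?D0 v2 = \<i>"
    by (rule noncritical_along_surj[OF nc differentiable_mixed_eval I])
  have lam_lim: "(\<lambda>n. lam n \<bullet> D n v) \<longlonglongrightarrow> z0 \<bullet> v" for v
    unfolding D_def lam[symmetric] by (intro tendsto_inner lim tendsto_const)
  have "lam \<longlonglongrightarrow> Complex (z0 \<bullet> v1) (z0 \<bullet> v2)" (is "_ \<longlonglongrightarrow> ?l")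
    using D_lim[of v1] D_lim[of v2] v1 v2 lam_lim
    by (intro multiplier_tendsto[of "\<lambda>n. D n v1" "\<lambda>n. D n v2"]) auto
  then have lim2: "(\<lambda>n. lam n \<bullet> D n v) \<longlonglongrightarrow> ?l \<bullet> ?D0 v" for v
    by (intro tendsto_inner D_lim)
  have "z0 \<in> {u + v | u v. u \<in> fiber_tangent I (mixed_eval f) z0 \<and> v \<in> sphere_tangent z0}"
    unfolding span by simp
  then obtain u v where z0: "z0 = u + v" and u: "?D0 u = 0" and v: "v \<bullet> z0 = 0"
    unfolding fiber_tangent_def sphere_tangent_def by blast
  have "z0 \<bullet> u = ?l \<bullet> ?D0 u"
    by (rule LIMSEQ_unique[OF lam_lim lim2])
  then have "z0 \<bullet> u = 0"
    using u by simp
  then have "z0 \<bullet> z0 = 0"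
    using v z0 by (metis add.right_neutral inner_add_right inner_commute)
  with \<open>z0 \<noteq> 0\<close> show False by simp
qed

text \<open>
  The definition passes through \<open>real_of_ereal\<close>, which sends infinite values to \<open>0\<close>; positivity
  ensures that the minimum is finite.
\<close>

lemma rho_zero_le:
  assumes "0 < rho_zero f r\<^sub>\<Delta> r\<^sub>0"
  shows "rho_zero f r\<^sub>\<Delta> r\<^sub>0 \<le> r\<^sub>0"
    and "\<And>\<Delta>. essential_face f \<Delta> \<Longrightarrow> face_index f \<Delta> \<in> vanishing_sets f \<Longrightarrow> rho_zero f r\<^sub>\<Delta> r\<^sub>0 \<le> r\<^sub>\<Delta> \<Delta>"
proof -
  let ?m = "min (r_nc f r\<^sub>\<Delta>) (ereal r\<^sub>0)"
  have m: "?m = ereal (rho_zero f r\<^sub>\<Delta> r\<^sub>0)"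
    using assms unfolding rho_zero_def by (cases ?m) auto
  have "ereal (rho_zero f r\<^sub>\<Delta> r\<^sub>0) \<le> ereal r\<^sub>0"
    unfolding m[symmetric] by (rule min.cobounded2)
  then show "rho_zero f r\<^sub>\<Delta> r\<^sub>0 \<le> r\<^sub>0" by simp
  fix \<Delta> assume \<Delta>: "essential_face f \<Delta>" "face_index f \<Delta> \<in> vanishing_sets f"
  have "ereal (rho_zero f r\<^sub>\<Delta> r\<^sub>0) \<le> r_nc f r\<^sub>\<Delta>"
    unfolding m[symmetric] by (rule min.cobounded1)
  also have "\<dots> \<le> r_subspace f r\<^sub>\<Delta> (face_index f \<Delta>)"
    unfolding r_nc_def by (rule INF_lower[OF \<Delta>(2)])
  also have "\<dots> \<le> ereal (r\<^sub>\<Delta> \<Delta>)"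
    unfolding r_subspace_def by (rule INF_lower) (use \<Delta>(1) in simp)
  finally show "rho_zero f r\<^sub>\<Delta> r\<^sub>0 \<le> r\<^sub>\<Delta> \<Delta>" by simp
qed

lemma tame_up_to_mono:
  assumes "tame_up_to f \<Delta> r" "0 \<le> s" "s \<le> r"
  shows "tame_up_to f \<Delta> s"
proof -
  have "s\<^sup>2 \<le> r\<^sup>2"
    using assms(2,3) by (intro power_mono)
  with assms(1) show ?thesis
    unfolding tame_up_to_def by (meson order_trans)
qed

section \<open>Transversality of nearby fibers\<close>

theorem lemma7:
  fixes f :: "'n::finite mixed_poly"
    and r\<^sub>\<Delta> :: "(real ^ 'n) set \<Rightarrow> real"
    and r\<^sub>0 r\<^sub>1 :: real
  assumes "strongly_nondegenerate f"
    and "locally_tame_along_vanishing f"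
    and "\<And>\<Delta>. essential_face f \<Delta> \<Longrightarrow> admissible_face_radius f \<Delta> (r\<^sub>\<Delta> \<Delta>)"
    and "admissible_ball_radius f r\<^sub>0"
    and "0 < r\<^sub>1" and "r\<^sub>1 \<le> rho_zero f r\<^sub>\<Delta> r\<^sub>0"
  shows "\<exists>\<delta>>0.
      (\<forall>\<eta>. 0 < cmod \<eta> \<and> cmod \<eta> \<le> \<delta> \<longrightarrow>
         no_mixed_singularity_in f \<eta> (cball 0 (rho_zero f r\<^sub>\<Delta> r\<^sub>0))) \<and>
      (\<forall>\<eta> r. 0 < cmod \<eta> \<and> cmod \<eta> \<le> \<delta> \<and> r\<^sub>1 \<le> r \<and> r \<le> rho_zero f r\<^sub>\<Delta> r\<^sub>0 \<longrightarrow>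
         transverse_to_sphere UNIV (mixed_eval f) (mixed_eval f -` {\<eta>}) r)"
proof (rule ccontr)
  assume neg: "\<not> ?thesis"
  let ?\<rho> = "rho_zero f r\<^sub>\<Delta> r\<^sub>0"
  have \<rho>: "0 < ?\<rho>"
    using assms(5,6) by linarith
  note \<rho>_le = rho_zero_le[OF \<rho>]
  obtain \<delta>0 where \<delta>0: "0 < \<delta>0"
      and smooth: "\<And>\<eta>. 0 < cmod \<eta> \<Longrightarrow> cmod \<eta> \<le> \<delta>0 \<Longrightarrow> no_mixed_singularity_in f \<eta> (cball 0 r\<^sub>0)"
    using assms(4) unfolding admissible_ball_radius_def by blast
  have smooth_\<rho>: "no_mixed_singularity_in f \<eta> (cball 0 ?\<rho>)" if "0 < cmod \<eta>" "cmod \<eta> \<le> \<delta>0" for \<eta>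
    using smooth[OF that] \<rho>_le(1) unfolding no_mixed_singularity_in_def by auto
  have "\<exists>z lam. mixed_eval f z \<noteq> 0 \<and> cmod (mixed_eval f z) \<le> inverse (real (Suc n)) \<and>
      r\<^sub>1 \<le> norm z \<and> norm z \<le> ?\<rho> \<and> (\<forall>v. z \<bullet> v = lam \<bullet> frechet_derivative (mixed_eval f) (at z) v)" for n
  proof -
    let ?\<delta> = "min \<delta>0 (inverse (real (Suc n)))"
    have "0 < ?\<delta>"
      using \<delta>0 by simp
    moreover have "\<forall>\<eta>. 0 < cmod \<eta> \<and> cmod \<eta> \<le> ?\<delta> \<longrightarrow> no_mixed_singularity_in f \<eta> (cball 0 ?\<rho>)"
      using smooth_\<rho> by simp
    ultimately obtain \<eta> r where \<eta>: "0 < cmod \<eta>" "cmod \<eta> \<le> ?\<delta>" and r: "r\<^sub>1 \<le> r" "r \<le> ?\<rho>"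
        and nt: "\<not> transverse_to_sphere UNIV (mixed_eval f) (mixed_eval f -` {\<eta>}) r"
      using neg by blast
    obtain z where "z \<in> mixed_eval f -` {\<eta>} \<inter> sphere 0 r"
      and bad: "\<not> (\<not> critical_point (mixed_eval f) z \<and>
        {u + v | u v. u \<in> fiber_tangent UNIV (mixed_eval f) z \<and> v \<in> sphere_tangent z} = UNIV)"
      using nt unfolding transverse_to_sphere_def by blast
    then have z: "mixed_eval f z = \<eta>" "norm z = r"
      by auto
    have nc: "\<not> critical_point (mixed_eval f) z"
      using smooth_\<rho>[of \<eta>] \<eta> z r unfolding no_mixed_singularity_in_def by simp
    with bad obtain lam where "\<And>v. z \<bullet> v = lam \<bullet> frechet_derivative (mixed_eval f) (at z) v"
      using nontransverse_multiplier[OF differentiable_mixed_eval nc] by blast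
    then show ?thesis
      using z \<eta> r by (intro exI[of _ z] exI[of _ lam]) auto
  qed
  then obtain z lam where nz: "\<And>n. mixed_eval f (z n) \<noteq> 0"
      and fz: "\<And>n. cmod (mixed_eval f (z n)) \<le> inverse (real (Suc n))"
      and z_norm: "\<And>n. r\<^sub>1 \<le> norm (z n)" "\<And>n. norm (z n) \<le> ?\<rho>"
      and lam: "\<And>n v. z n \<bullet> v = lam n \<bullet> frechet_derivative (mixed_eval f) (at (z n)) v"
    by metis
  have "bounded (range z)"
    using z_norm(2) unfolding bounded_iff by blast
  then obtain z0 s where s: "strict_mono s" and "(z \<circ> s) \<longlonglongrightarrow> z0"
    using bounded_imp_convergent_subsequence by blast
  then have lim: "(\<lambda>n. z (s n)) \<longlonglongrightarrow> z0"
    by (simp add: o_def)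
  have z0_norm: "r\<^sub>1 \<le> norm z0" "norm z0 \<le> ?\<rho>"
    using z_norm LIMSEQ_le_const[OF tendsto_norm[OF lim]] LIMSEQ_le_const2[OF tendsto_norm[OF lim]] by blast+
  then have z0: "z0 \<noteq> 0"
    using assms(5) by auto
  have "(\<lambda>n. mixed_eval f (z n)) \<longlonglongrightarrow> 0"
    by (rule Lim_null_comparison[OF _ LIMSEQ_inverse_real_of_nat]) (intro always_eventually allI fz)
  then have "(\<lambda>n. mixed_eval f (z (s n))) \<longlonglongrightarrow> 0"
    using LIMSEQ_subseq_LIMSEQ[OF _ s] by (fastforce simp: o_def)
  moreover have "(\<lambda>n. mixed_eval f (z (s n))) \<longlonglongrightarrow> mixed_eval f z0"
    by (rule isCont_tendsto_compose[OF _ lim])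
       (rule differentiable_imp_continuous_within[OF differentiable_mixed_eval])
  ultimately have fz0: "mixed_eval f z0 = 0"
    using LIMSEQ_unique by blast
  let ?I = "{i. z0 $ i \<noteq> 0}"
  have "?I \<noteq> {}"
    using z0 by (auto simp: vec_eq_iff)
  show False
  proof (cases "?I \<in> nonvanishing_sets f")
    case True
    have z0V: "z0 \<in> V_torus f ?I \<inter> sphere 0 (norm z0)"
      using fz0 by (simp add: V_torus_def coord_torus_def coord_subspace_def)
    have "0 < norm z0" "norm z0 \<le> r\<^sub>0"
      using z0 z0_norm \<rho>_le(1) by auto
    then have "transverse_to_sphere (coord_subspace ?I) (mixed_eval f) (V_torus f ?I) (norm z0)"
      using assms(4) True unfolding admissible_ball_radius_def by blast
    then show False
      using transverse_limit_excludes_multipliers[OF lim z0 subspace_coord_subspace _ _ lam] z0V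
      unfolding transverse_to_sphere_def by blast
  next
    case False
    then have I: "?I \<in> vanishing_sets f"
      using \<open>?I \<noteq> {}\<close> unfolding nonvanishing_sets_def vanishing_sets_def by blast
    show False
    proof (rule tame_face_excludes_multipliers[OF lim I nz lam])
      fix \<Delta> assume \<Delta>: "essential_face f \<Delta>" "face_index f \<Delta> = ?I"
      have "norm z0 \<le> r\<^sub>\<Delta> \<Delta>"
        using \<rho>_le(2)[OF \<Delta>(1)] \<Delta>(2) I z0_norm(2) by simp
      then show "tame_up_to f \<Delta> (norm z0)"
        using assms(3)[OF \<Delta>(1)] unfolding admissible_face_radius_def
        by (blast intro: tame_up_to_mono norm_ge_zero)
    qed
  qed
qed

end
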